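(* For every integer $N\ge2$ there are constants $a(N),A(N),b(N),B(N)>0$ depending only on $N$ such that for every integer $n\ge0$ the following holds. Let $d=\log_3(N+1)$ and $\gamma=\mathrm{diam}(\mathcal V_N(n))=2\cdot3^n$. The spectral profile $\Lambda$ of simple random walk on the Viscek graph $\mathcal V_N(n)$ satisfies, for $\pi_*\le r\le 1$, $$\frac{a(N)}{\gamma^{d+1} r^{1+1/d}} \leq \Lambda(r) \leq \frac{A(N)}{\gamma^{d+1} r^{1+1/d}}.$$ In particular, the mixing times of the continuous-time walk satisfy $$b(N)\gamma^{d+1} \leq \tau_1(1/e) \leq \tau_{\infty}(1/e) \leq B(N)\gamma^{d+1}.$$
   Context: Viscek graphs: for $N\ge2$, $\mathcal V_N(0)$ is the star graph on $N+1$ vertices (a central vertex joined to $N$ other vertices). Given $\mathcal V_N(n-1)$, choose $N$ vertices $x_1,\dots,x_N$ with $d(x_i,x_j)=\mathrm{diam}(\mathcal V_N(n-1))$ for all $i\ne j$ ($d$ here being graph distance). $\mathcal V_N(n)$ is obtained from $N+1$ disjoint copies $\mathcal V_N^0(n-1),\dots,\mathcal V_N^N(n-1)$ of $\mathcal V_N(n-1)$ by identifying, for each $1\le i\le N$, the copy of $x_i$ in $\mathcal V_N^0(n-1)$ with the copy of $x_i$ in $\mathcal V_N^i(n-1)$. (Different choices of $x_1,\dots,x_N$ give isomorphic graphs.) Simple random walk on a finite graph: $K(x,y)=1/\deg(x)$ if $x,y$ are adjacent and $0$ otherwise; its invariant probability measure $\pi$ is proportional to degree, and $\pi_*=\min_x\pi(x)$.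 The continuous-time walk has kernel $H_t(x,y)=e^{-t}\sum_{k\ge0}\frac{t^k}{k!}K^k(x,y)$. For $1\le p\le\infty$, $\tau_p(\epsilon)=\inf\{t>0:\ \sup_{x}\|H_t(x,\cdot)/\pi(\cdot)-1\|_{L^p(\pi)}\le\epsilon\}$. The spectral profile is $$\Lambda(r)=\inf_{\pi_*\le\pi(S)\le r}\ \inf_{f\in c_0^+(S)}\frac{\mathcal E(f,f)}{\mathrm{Var}(f)},\qquad r\ge\pi_*,$$ where $\mathcal E(f,g)=\langle(I-K)f,g\rangle_\pi$, $\mathrm{Var}$ is the variance with respect to $\pi$, and $c_0^+(S)$ is the set of non-constant functions $f\ge0$ with support contained in $S$. *)

theory Defs
  imports "HOL-Analysis.Analysis"
begin

section \<open>Finite simple graphs\<close>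

text \<open>A graph is given by its vertex set \<open>V\<close> and its adjacency relation \<open>E\<close>, a symmetric and
  irreflexive set of ordered pairs of elements of \<open>V\<close>.\<close>

definition graph_dist :: "('v \<times> 'v) set \<Rightarrow> 'v \<Rightarrow> 'v \<Rightarrow> nat" where
  "graph_dist E u v = (LEAST k. (u, v) \<in> E ^^ k)"

definition graph_diam :: "'v set \<Rightarrow> ('v \<times> 'v) set \<Rightarrow> nat" where
  "graph_diam V E = Max {graph_dist E u v | u v. u \<in> V \<and> v \<in> V}"

definition vert_degree :: "('v \<times> 'v) set \<Rightarrow> 'v \<Rightarrow> nat" where
  "vert_degree E x = card {y. (x, y) \<in> E}"

section \<open>Viscek graphs\<close>

text \<open>Vertices are lists of natural numbers. In the star, \<open>[0]\<close> is the centre. When copies are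
  glued, \<open>i # v\<close> stands for the vertex \<open>v\<close> of the \<open>i\<close>-th copy; since the vertices \<open>x i\<close> of the
  copies \<open>0\<close> and \<open>i\<close> are identified, both are represented by \<open>0 # x i\<close>. Apart from these
  identifications the copies are disjoint.\<close>

definition star_verts :: "nat \<Rightarrow> nat list set" where
  "star_verts N = {[i] | i. i \<le> N}"

definition star_edges :: "nat \<Rightarrow> (nat list \<times> nat list) set" where
  "star_edges N = {([0], [i]) | i. 1 \<le> i \<and> i \<le> N} \<union> {([i], [0]) | i. 1 \<le> i \<and> i \<le> N}"

definition copy_vert :: "(nat \<Rightarrow> nat list) \<Rightarrow> nat \<Rightarrow> nat list \<Rightarrow> nat list" where
  "copy_vert x i v = (if 1 \<le> i \<and> v = x i then 0 # v else i # v)"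

definition glue_verts :: "nat \<Rightarrow> (nat \<Rightarrow> nat list) \<Rightarrow> nat list set \<Rightarrow> nat list set" where
  "glue_verts N x V = (\<Union>i\<le>N. copy_vert x i ` V)"

definition glue_edges ::
  "nat \<Rightarrow> (nat \<Rightarrow> nat list) \<Rightarrow> (nat list \<times> nat list) set \<Rightarrow> (nat list \<times> nat list) set" where
  "glue_edges N x E = (\<Union>i\<le>N. map_prod (copy_vert x i) (copy_vert x i) ` E)"

text \<open>\<open>viscek N n V E\<close>: the graph \<open>(V, E)\<close> is an \<open>n\<close>-th Viscek graph, obtained by some choice of
  the vertices \<open>x 1, \<dots>, x N\<close> at each of the \<open>n\<close> steps.\<close>

inductive viscek ::
  "nat \<Rightarrow> nat \<Rightarrow> nat list set \<Rightarrow> (nat list \<times> nat list) set \<Rightarrow> bool" for N :: nat where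
  viscek_0: "viscek N 0 (star_verts N) (star_edges N)"
| viscek_Suc: "\<lbrakk>viscek N n V E;
     \<forall>i\<in>{1..N}. x i \<in> V;
     \<forall>i\<in>{1..N}. \<forall>j\<in>{1..N}. i \<noteq> j \<longrightarrow> graph_dist E (x i) (x j) = graph_diam V E\<rbrakk>
   \<Longrightarrow> viscek N (Suc n) (glue_verts N x V) (glue_edges N x E)"

section \<open>Simple random walk on a finite graph\<close>

definition srw_kernel :: "('v \<times> 'v) set \<Rightarrow> 'v \<Rightarrow> 'v \<Rightarrow> real" where
  "srw_kernel E x y = (if (x, y) \<in> E then 1 / real (vert_degree E x) else 0)"

fun srw_kernel_pow :: "'v set \<Rightarrow> ('v \<times> 'v) set \<Rightarrow> nat \<Rightarrow> 'v \<Rightarrow> 'v \<Rightarrow> real" where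
  "srw_kernel_pow V E 0 x y = (if x = y then 1 else 0)"
| "srw_kernel_pow V E (Suc k) x y = (\<Sum>z\<in>V. srw_kernel E x z * srw_kernel_pow V E k z y)"

definition heat_kernel :: "'v set \<Rightarrow> ('v \<times> 'v) set \<Rightarrow> real \<Rightarrow> 'v \<Rightarrow> 'v \<Rightarrow> real" where
  "heat_kernel V E t x y = exp (- t) * (\<Sum>k. t ^ k / fact k * srw_kernel_pow V E k x y)"

definition stat :: "'v set \<Rightarrow> ('v \<times> 'v) set \<Rightarrow> 'v \<Rightarrow> real" where
  "stat V E x = real (vert_degree E x) / (\<Sum>y\<in>V. real (vert_degree E y))"

definition stat_min :: "'v set \<Rightarrow> ('v \<times> 'v) set \<Rightarrow> real" where
  "stat_min V E = Min (stat V E ` V)"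

text \<open>The norm of \<open>L\<^sup>p(\<pi>)\<close> for \<open>1 \<le> p \<le> \<infinity>\<close>; for \<open>p = \<infinity>\<close> it is the essential supremum, which
  ignores points of measure zero.\<close>

definition lp_norm :: "'v set \<Rightarrow> ('v \<times> 'v) set \<Rightarrow> ennreal \<Rightarrow> ('v \<Rightarrow> real) \<Rightarrow> real" where
  "lp_norm V E p f =
     (if p = \<infinity> then Max {\<bar>f x\<bar> | x. x \<in> V \<and> stat V E x > 0}
      else (\<Sum>x\<in>V. \<bar>f x\<bar> powr enn2real p * stat V E x) powr (1 / enn2real p))"

definition mixing_time :: "'v set \<Rightarrow> ('v \<times> 'v) set \<Rightarrow> ennreal \<Rightarrow> real \<Rightarrow> ereal" where
  "mixing_time V E p \<epsilon> =
     Inf {ereal t | t. t > 0 \<and>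
       (MAX x\<in>V. lp_norm V E p (\<lambda>y. heat_kernel V E t x y / stat V E y - 1)) \<le> \<epsilon>}"

section \<open>Spectral profile\<close>

definition stat_inner :: "'v set \<Rightarrow> ('v \<times> 'v) set \<Rightarrow> ('v \<Rightarrow> real) \<Rightarrow> ('v \<Rightarrow> real) \<Rightarrow> real" where
  "stat_inner V E f g = (\<Sum>x\<in>V. f x * g x * stat V E x)"

definition dirichlet_form :: "'v set \<Rightarrow> ('v \<times> 'v) set \<Rightarrow> ('v \<Rightarrow> real) \<Rightarrow> ('v \<Rightarrow> real) \<Rightarrow> real" where
  "dirichlet_form V E f g = stat_inner V E (\<lambda>x. f x - (\<Sum>y\<in>V. srw_kernel E x y * f y)) g"

definition stat_mean :: "'v set \<Rightarrow> ('v \<times> 'v) set \<Rightarrow> ('v \<Rightarrow> real) \<Rightarrow> real" where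
  "stat_mean V E f = (\<Sum>x\<in>V. f x * stat V E x)"

definition stat_var :: "'v set \<Rightarrow> ('v \<times> 'v) set \<Rightarrow> ('v \<Rightarrow> real) \<Rightarrow> real" where
  "stat_var V E f = (\<Sum>x\<in>V. (f x - stat_mean V E f)\<^sup>2 * stat V E x)"

text \<open>The class \<open>c\<^sub>0\<^sup>+(S)\<close>. Only the values on \<open>V\<close> matter.\<close>

definition c0_plus :: "'v set \<Rightarrow> 'v set \<Rightarrow> ('v \<Rightarrow> real) set" where
  "c0_plus V S =
     {f. (\<forall>x\<in>V. f x \<ge> 0) \<and> {x \<in> V. f x \<noteq> 0} \<subseteq> S \<and> \<not> f constant_on V}"

definition spectral_profile :: "'v set \<Rightarrow> ('v \<times> 'v) set \<Rightarrow> real \<Rightarrow> real" where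
  "spectral_profile V E r =
     (INF S \<in> {S. S \<subseteq> V \<and> stat_min V E \<le> (\<Sum>x\<in>S. stat V E x) \<and> (\<Sum>x\<in>S. stat V E x) \<le> r}.
        INF f \<in> c0_plus V S. dirichlet_form V E f f / stat_var V E f)"

end

theory Submission
  imports Defs
begin

text \<open>
  Write \<open>q = N + 1\<close>, and measure everything on ordered edges: the energy of \<open>f\<close> is the sum of
  \<open>(f u - f v)\<^sup>2\<close> over ordered edges, and the mass of a vertex is its degree. Both are additive when
  copies of a graph are glued at single vertices, so every property of a Viscek graph needed here is
  proved by one induction along the construction. The graph of level \<open>n\<close> has \<open>2 N q\<^sup>n\<close> ordered edges
  and diameter \<open>2 \<cdot> 3\<^sup>n\<close>, so \<open>\<gamma>\<^sup>d\<^sup>+\<^sup>1\<close> is \<open>(3 q)\<^sup>n\<close> up to a constant: mass times diameter.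

  Lower bound for the profile. Two vertices are joined through at most three copies of the previous
  level, hence \<open>(f u - f v)\<^sup>2 \<le> 3\<^sup>n\<close> times the energy (\<open>viscek_oscillation\<close>). If the support of
  \<open>f\<close> has less mass than a copy of level \<open>k\<close>, then \<open>f\<close> vanishes somewhere in each such copy, and
  the oscillation bound in the copies gives \<open>\<Sum> f\<^sup>2 \<le> 2 N (3 q)\<^sup>k\<close> times the energy
  (\<open>viscek_faber_krahn\<close>). It remains to choose \<open>k\<close> with \<open>q\<^sup>k\<close> comparable to \<open>r q\<^sup>n\<close>.

  Upper bound for the profile. A path between two antipodal vertices carries a function that rises
  linearly along it and is constant on everything that hangs off it; its energy is at most \<open>3\<^sup>-\<^sup>n\<close>
  (\<open>viscek_two_point\<close>). Placed in the outer copies of a graph of level \<open>m + 1\<close>, such functions cut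
  off a plateau of height \<open>1\<close> on its central copy, so that the result vanishes at the corners.
  This bump extends by zero to all higher levels (\<open>viscek_bump\<close>), with energy at most \<open>N 3\<^sup>-\<^sup>m\<close>
  and square sum at least \<open>2 N q\<^sup>m\<close>.

  Mixing times. Put \<open>\<phi>(t) = \<parallel>H\<^sub>t(x,\<cdot>)/\<pi> - 1\<parallel>\<^sup>2\<close>. Then \<open>\<phi>(t/2)\<close> is the value at \<open>x\<close> of the
  mean-zero function \<open>H\<^sub>t(x,\<cdot>)/\<pi> - 1\<close>, so an oscillation bound with constant \<open>R\<close> gives
  \<open>\<phi>' \<le> - \<phi>\<^sup>2 / (R |E|)\<close>, and \<open>\<phi>\<close> decays like \<open>R |E| / t\<close>; this bounds \<open>\<tau>\<^sub>\<infinity>\<close> by a multiple of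
  \<open>3\<^sup>n |E|\<close> (\<open>mixing_time_infinity_le\<close>). For the lower
  bound, the variance of \<open>H\<^sub>t f\<close> decreases at a rate of at most twice the Dirichlet form of \<open>f\<close>,
  whereas mixing in \<open>L\<^sup>1\<close> makes it small (\<open>mixing_time_1_ge\<close>). The test function separates one half
  of the outer copies from the other half, with all its energy in the central copy
  (\<open>viscek_split\<close>).
\<close>

section \<open>Energy of functions on a graph\<close>

text \<open>Each undirected edge is counted twice. Without the normalisation of the Dirichlet form,
  the energy of a glued graph is the sum of the energies of its copies.\<close>
definition edge_energy :: "('v \<times> 'v) set \<Rightarrow> ('v \<Rightarrow> real) \<Rightarrow> real" where
  "edge_energy E f = (\<Sum>(u, v)\<in>E. (f u - f v)\<^sup>2)"

lemma edge_energy_nonneg: "edge_energy E f \<ge> 0"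
  unfolding edge_energy_def by (rule sum_nonneg) auto

lemma energy_affine: "edge_energy E (\<lambda>v. (b + s v) / a) = edge_energy E s / a\<^sup>2"
proof -
  have "edge_energy E (\<lambda>v. (b + s v) / a) = (\<Sum>(u, v)\<in>E. (s u - s v)\<^sup>2 / a\<^sup>2)"
    unfolding edge_energy_def
    by (rule sum.cong) (auto simp: diff_divide_distrib[symmetric] power_divide)
  then show ?thesis by (simp add: edge_energy_def sum_divide_distrib case_prod_unfold)
qed

lemma energy_const: "edge_energy E (\<lambda>v. k) = 0"
  by (simp add: edge_energy_def case_prod_unfold)

text \<open>The difference of two minima is bounded, on either side, by the difference at the index where
  the smaller minimum is attained.\<close>
lemma square_min_diff_le:
  fixes p q :: "'i \<Rightarrow> real"
  assumes "finite I" "I \<noteq> {}"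
  shows "((MIN i\<in>I. p i) - (MIN i\<in>I. q i))\<^sup>2 \<le> (\<Sum>i\<in>I. (p i - q i)\<^sup>2)"
proof -
  have *: "(Min (p ` I) - Min (q ` I))\<^sup>2 \<le> (\<Sum>i\<in>I. (p i - q i)\<^sup>2)"
    if "Min (q ` I) \<le> Min (p ` I)" for p q :: "'i \<Rightarrow> real"
  proof -
    have "Min (q ` I) \<in> q ` I" using assms by (intro Min_in) auto
    then obtain i where i: "i \<in> I" "q i = Min (q ` I)" by auto
    have "Min (p ` I) \<le> p i" using assms i by (intro Min_le) auto
    then have "(Min (p ` I) - Min (q ` I))\<^sup>2 \<le> (p i - q i)\<^sup>2" using that i by (intro power_mono) auto
    also have "\<dots> \<le> (\<Sum>i\<in>I. (p i - q i)\<^sup>2)" using assms i by (intro member_le_sum) auto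
    finally show ?thesis .
  qed
  show ?thesis
  proof (cases "Min (q ` I) \<le> Min (p ` I)")
    case False
    then show ?thesis using *[of p q] by (simp add: power2_commute)
  qed (rule *)
qed

text \<open>Finitely many cutoffs can be combined into one whose energy is at most the sum of theirs.\<close>
lemma energy_min_le:
  assumes "finite I" "I \<noteq> {}"
  shows "edge_energy E (\<lambda>v. MIN i\<in>I. t i v) \<le> (\<Sum>i\<in>I. edge_energy E (t i))"
proof -
  have "edge_energy E (\<lambda>v. MIN i\<in>I. t i v) \<le> (\<Sum>(u, v)\<in>E. \<Sum>i\<in>I. (t i u - t i v)\<^sup>2)"
    unfolding edge_energy_def by (intro sum_mono) (use square_min_diff_le[OF assms] in auto)
  also have "\<dots> = (\<Sum>i\<in>I. edge_energy E (t i))"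
    unfolding edge_energy_def case_prod_unfold by (rule sum.swap)
  finally show ?thesis .
qed

lemma energy_complement: "edge_energy E (\<lambda>v. 1 - s v) = edge_energy E s"
  unfolding edge_energy_def by (rule sum.cong) (auto simp: power2_commute)

section \<open>Simple random walk and spectral profile\<close>

locale finite_graph =
  fixes V :: "'v set" and E :: "('v \<times> 'v) set"
  assumes finite_verts: "finite V"
    and verts_nonempty: "V \<noteq> {}"
    and edges_sub: "E \<subseteq> V \<times> V"
    and sym_edges: "sym E"
    and irrefl_edges: "irrefl E"
    and has_edge: "\<And>x. x \<in> V \<Longrightarrow> \<exists>y. (x, y) \<in> E"
    and connected: "\<And>u v. u \<in> V \<Longrightarrow> v \<in> V \<Longrightarrow> (u, v) \<in> E\<^sup>*"
begin

lemma finite_edges: "finite E"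
  using finite_subset[OF edges_sub] finite_verts by simp

lemma edge_verts: "(u, v) \<in> E \<Longrightarrow> u \<in> V" "(u, v) \<in> E \<Longrightarrow> v \<in> V"
  using edges_sub by auto

lemma finite_neighbours: "finite {y. (x, y) \<in> E}"
  by (rule finite_subset[OF _ finite_verts]) (auto dest: edge_verts)

lemma sum_edges_swap: "(\<Sum>(u, v)\<in>E. g u v) = (\<Sum>(u, v)\<in>E. g v u)"
  by (rule sum.reindex_bij_witness[of _ prod.swap prod.swap]) (use sym_edges in \<open>auto dest: symD\<close>)

lemma sum_neighbours: "(\<Sum>x\<in>V. \<Sum>y | (x, y) \<in> E. g x y) = (\<Sum>(u, v)\<in>E. g u v)"
proof -
  have "Sigma V (\<lambda>x. {y. (x, y) \<in> E}) = E" by (auto dest: edge_verts)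
  then show ?thesis
    using sum.Sigma[OF finite_verts, of "\<lambda>x. {y. (x, y) \<in> E}" g] finite_neighbours by simp
qed

lemma degree_pos: "x \<in> V \<Longrightarrow> vert_degree E x > 0"
  unfolding vert_degree_def using has_edge finite_neighbours by (fastforce simp: card_gt_0_iff)

lemma edges_nonempty: "card E > 0"
  using verts_nonempty has_edge finite_edges by (fastforce simp: card_gt_0_iff)

text \<open>The stationary measure is the first marginal of the uniform distribution on ordered edges; this
  turns every stationary average into an edge sum.\<close>
lemma sum_degree: "(\<Sum>x\<in>V. g x * real (vert_degree E x)) = (\<Sum>(u, v)\<in>E. g u)"
  using sum_neighbours[of "\<lambda>x y. g x"] by (simp add: vert_degree_def mult.commute)

lemma stat_eq: "stat V E x = real (vert_degree E x) / real (card E)"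
  using sum_degree[of "\<lambda>_. 1"] by (simp add: stat_def case_prod_unfold)

lemma sum_stat: "(\<Sum>x\<in>V. g x * stat V E x) = (\<Sum>(u, v)\<in>E. g u) / real (card E)"
  by (simp add: stat_eq sum_degree[symmetric] sum_divide_distrib)

lemma stat_pos: "x \<in> V \<Longrightarrow> stat V E x > 0"
  using degree_pos edges_nonempty by (simp add: stat_eq)

lemma stat_nonneg: "x \<in> V \<Longrightarrow> stat V E x \<ge> 0"
  using stat_pos by (simp add: less_imp_le)

lemma sum_stat_1: "(\<Sum>x\<in>V. stat V E x) = 1"
  using sum_stat[of "\<lambda>_. 1"] edges_nonempty by (simp add: case_prod_unfold)

lemma kernel_sum:
  "(\<Sum>y\<in>V. srw_kernel E x y * f y) = (\<Sum>y | (x, y) \<in> E. f y) / real (vert_degree E x)"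
proof -
  have "(\<Sum>y\<in>V. srw_kernel E x y * f y) = (\<Sum>y | (x, y) \<in> E. f y / real (vert_degree E x))"
    by (rule sum.mono_neutral_cong_right) (auto simp: srw_kernel_def finite_verts dest: edge_verts)
  then show ?thesis by (simp add: sum_divide_distrib)
qed

lemma kernel_row_sum: "x \<in> V \<Longrightarrow> (\<Sum>y\<in>V. srw_kernel E x y) = 1"
  using kernel_sum[of x "\<lambda>_. 1"] degree_pos[of x] by (simp add: vert_degree_def)

lemma dirichlet_eq:
  "dirichlet_form V E f g = (\<Sum>(u, v)\<in>E. (f u - f v) * (g u - g v)) / (2 * real (card E))"
proof -
  have "dirichlet_form V E f g * real (card E)
      = (\<Sum>x\<in>V. \<Sum>y | (x, y) \<in> E. (f x - f y) * g x)"
    unfolding dirichlet_form_def stat_inner_def sum_distrib_right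
  proof (rule sum.cong[OF refl])
    fix x assume "x \<in> V"
    then have d: "real (vert_degree E x) > 0" using degree_pos by simp
    have "(\<Sum>y | (x, y) \<in> E. (f x - f y) * g x)
        = (real (vert_degree E x) * f x - (\<Sum>y | (x, y) \<in> E. f y)) * g x"
      by (simp add: sum_distrib_right[symmetric] sum_subtractf vert_degree_def)
    then show "(f x - (\<Sum>y\<in>V. srw_kernel E x y * f y)) * g x * stat V E x * real (card E)
        = (\<Sum>y | (x, y) \<in> E. (f x - f y) * g x)"
      using d edges_nonempty by (simp only: kernel_sum stat_eq) (simp add: divide_simps)
  qed
  also have "\<dots> = (\<Sum>(u, v)\<in>E. (f u - f v) * g u)" by (rule sum_neighbours)
  finally have 1: "dirichlet_form V E f g * real (card E) = (\<Sum>(u, v)\<in>E. (f u - f v) * g u)" .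
  also have "\<dots> = (\<Sum>(u, v)\<in>E. (f v - f u) * g v)" by (rule sum_edges_swap)
  finally have "2 * (dirichlet_form V E f g * real (card E))
      = (\<Sum>(u, v)\<in>E. (f u - f v) * g u) + (\<Sum>(u, v)\<in>E. (f v - f u) * g v)"
    using 1 by simp
  also have "\<dots> = (\<Sum>(u, v)\<in>E. (f u - f v) * (g u - g v))"
    unfolding sum.distrib[symmetric] by (rule sum.cong) (auto simp: algebra_simps)
  finally show ?thesis using edges_nonempty by (simp add: field_simps)
qed

lemma dirichlet_energy: "dirichlet_form V E f f = edge_energy E f / (2 * real (card E))"
  by (simp add: dirichlet_eq edge_energy_def power2_eq_square)

lemma dirichlet_commute: "dirichlet_form V E f g = dirichlet_form V E g f"
  by (simp add: dirichlet_eq mult.commute)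

lemma dirichlet_nonneg: "dirichlet_form V E f f \<ge> 0"
  by (simp add: dirichlet_energy edge_energy_nonneg)

lemma sum_sq_shift:
  "(\<Sum>x\<in>V. (f x - c)\<^sup>2 * stat V E x) = stat_var V E f + (stat_mean V E f - c)\<^sup>2"
proof -
  have *: "(\<Sum>x\<in>V. (f x - c)\<^sup>2 * stat V E x)
     = (\<Sum>x\<in>V. (f x)\<^sup>2 * stat V E x) - 2 * c * stat_mean V E f + c\<^sup>2" for c
  proof -
    have "(\<Sum>x\<in>V. (f x - c)\<^sup>2 * stat V E x)
      = (\<Sum>x\<in>V. (f x)\<^sup>2 * stat V E x - 2 * c * (f x * stat V E x) + c\<^sup>2 * stat V E x)"
      by (rule sum.cong) (auto simp: power2_eq_square algebra_simps)
    then show ?thesis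
      by (simp add: sum.distrib sum_subtractf sum_distrib_left[symmetric] sum_stat_1 stat_mean_def)
  qed
  show ?thesis
    unfolding stat_var_def * by (simp add: power2_eq_square algebra_simps)
qed

lemma var_le_sum_sq: "stat_var V E f \<le> (\<Sum>x\<in>V. (f x - c)\<^sup>2 * stat V E x)"
  by (simp add: sum_sq_shift)

lemma var_eq: "stat_var V E f = (\<Sum>x\<in>V. (f x)\<^sup>2 * stat V E x) - (stat_mean V E f)\<^sup>2"
  using sum_sq_shift[of f 0] by simp

lemma var_nonneg: "stat_var V E f \<ge> 0"
  unfolding stat_var_def by (rule sum_nonneg) (simp add: stat_nonneg)

lemma var_pos: assumes "\<not> f constant_on V" shows "stat_var V E f > 0"
proof (rule ccontr)
  assume "\<not> ?thesis"
  then have "(\<Sum>x\<in>V. (f x - stat_mean V E f)\<^sup>2 * stat V E x) = 0"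
    using var_nonneg[of f] by (simp add: stat_var_def)
  moreover have "\<And>x. x \<in> V \<Longrightarrow> (f x - stat_mean V E f)\<^sup>2 * stat V E x \<ge> 0"
    by (simp add: stat_nonneg)
  ultimately have "\<forall>x\<in>V. (f x - stat_mean V E f)\<^sup>2 * stat V E x = 0"
    using sum_nonneg_eq_0_iff[OF finite_verts, of "\<lambda>x. (f x - stat_mean V E f)\<^sup>2 * stat V E x"] by metis
  then have "\<forall>x\<in>V. f x = stat_mean V E f" using stat_pos by (metis less_irrefl mult_eq_0_iff power2_eq_square right_minus_eq)
  then show False using assms by (auto simp: constant_on_def)
qed

text \<open>The edges leaving \<open>x\<close> and their reversals are disjoint subsets of the edge set.\<close>
lemma singleton_mass_le_half: assumes "x \<in> V" shows "stat V E x \<le> 1 / 2"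
proof -
  let ?A = "(\<lambda>y. (x, y)) ` {y. (x, y) \<in> E}" and ?B = "(\<lambda>y. (y, x)) ` {y. (x, y) \<in> E}"
  have "?A \<inter> ?B = {}" using irrefl_edges by (auto simp: irrefl_def)
  moreover have "?A \<union> ?B \<subseteq> E" using sym_edges by (auto dest: symD)
  ultimately have "card ?A + card ?B \<le> card E"
    using finite_neighbours[of x] by (metis card_Un_disjoint card_mono finite_edges finite_imageI)
  then have "2 * vert_degree E x \<le> card E"
    by (simp add: card_image inj_on_def vert_degree_def)
  then show ?thesis using edges_nonempty by (simp add: stat_eq field_simps)
qed

lemma not_constant_if_small_support:
  assumes "f v \<noteq> 0" "v \<in> V" "(\<Sum>x | x \<in> V \<and> f x \<noteq> 0. stat V E x) \<le> 1 / 2"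
  shows "\<not> f constant_on V"
proof
  assume "f constant_on V"
  then have "{x. x \<in> V \<and> f x \<noteq> 0} = V" using assms(1,2) by (auto simp: constant_on_def)
  then show False using assms(3) sum_stat_1 by simp
qed

text \<open>Cauchy--Schwarz on the support bounds the squared mean by the mass of the support times the
  second moment.\<close>
lemma var_ge_small_support:
  assumes "(\<Sum>x | x \<in> V \<and> f x \<noteq> 0. stat V E x) \<le> 1 / 2"
  shows "stat_var V E f \<ge> (\<Sum>x\<in>V. (f x)\<^sup>2 * stat V E x) / 2"
proof -
  let ?S = "{x. x \<in> V \<and> f x \<noteq> 0}" and ?q = "\<Sum>x\<in>V. (f x)\<^sup>2 * stat V E x"
  have m: "stat_mean V E f = (\<Sum>x\<in>?S. (f x * sqrt (stat V E x)) * sqrt (stat V E x))"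
    unfolding stat_mean_def
    by (rule sum.mono_neutral_cong_right) (use finite_verts stat_nonneg in \<open>auto simp: mult.assoc\<close>)
  have q: "?q = (\<Sum>x\<in>?S. (f x * sqrt (stat V E x))\<^sup>2)"
    by (rule sum.mono_neutral_cong_right) (use finite_verts stat_nonneg in \<open>auto simp: power_mult_distrib\<close>)
  have "(stat_mean V E f)\<^sup>2 \<le> ?q * (\<Sum>x\<in>?S. (sqrt (stat V E x))\<^sup>2)"
    unfolding m q by (rule Cauchy_Schwarz_ineq_sum)
  also have "(\<Sum>x\<in>?S. (sqrt (stat V E x))\<^sup>2) = (\<Sum>x\<in>?S. stat V E x)"
    by (rule sum.cong) (use stat_nonneg in auto)
  also have "?q * \<dots> \<le> ?q * (1 / 2)"
    using assms by (intro mult_left_mono sum_nonneg) (auto simp: stat_nonneg)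
  finally show ?thesis by (simp add: var_eq)
qed

lemma profile_inner_bdd: "bdd_below ((\<lambda>f. dirichlet_form V E f f / stat_var V E f) ` F)"
  by (rule bdd_belowI[of _ 0]) (auto simp: dirichlet_nonneg var_nonneg)

lemma indicator_in_c0_plus:
  assumes "x \<in> S" "S \<subseteq> V" shows "(\<lambda>y. if y = x then 1 else 0) \<in> c0_plus V S"
proof -
  have "x \<in> V" using assms by auto
  moreover have "{y. y \<in> V \<and> (if y = x then (1::real) else 0) \<noteq> 0} = {x}"
    using \<open>x \<in> V\<close> by auto
  ultimately have "\<not> (\<lambda>y. if y = x then (1::real) else 0) constant_on V"
    by (intro not_constant_if_small_support[of _ x]) (use singleton_mass_le_half in auto)
  then show ?thesis using assms by (auto simp: c0_plus_def)
qed

lemma stat_min_le: "x \<in> V \<Longrightarrow> stat_min V E \<le> stat V E x"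
  unfolding stat_min_def using finite_verts by simp

lemma stat_min_attained: "\<exists>x\<in>V. stat V E x = stat_min V E"
proof -
  have "stat_min V E \<in> stat V E ` V"
    unfolding stat_min_def using finite_verts verts_nonempty by (intro Min_in) auto
  then show ?thesis by auto
qed

lemma stat_min_ge: "stat_min V E \<ge> 1 / real (card E)"
proof -
  obtain x where "x \<in> V" "stat V E x = stat_min V E" using stat_min_attained by auto
  moreover have "real (vert_degree E x) \<ge> 1" using degree_pos[OF \<open>x \<in> V\<close>] by simp
  ultimately show ?thesis by (metis stat_eq divide_right_mono of_nat_0_le_iff)
qed

lemma stat_min_le_mass:
  assumes "S \<subseteq> V" "S \<noteq> {}" shows "stat_min V E \<le> (\<Sum>x\<in>S. stat V E x)"
proof -
  obtain x where x: "x \<in> S" using assms by auto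
  have "finite S" using assms finite_verts finite_subset by auto
  then have "stat V E x \<le> (\<Sum>x\<in>S. stat V E x)"
    using x assms(1) by (intro member_le_sum) (auto intro!: stat_nonneg)
  then show ?thesis using stat_min_le[of x] x assms(1) by fastforce
qed

lemma nonempty_if_mass: "stat_min V E \<le> (\<Sum>x\<in>S. stat V E x) \<Longrightarrow> S \<noteq> {}"
  using stat_min_ge edges_nonempty
  by (metis divide_pos_pos less_le_trans of_nat_0_less_iff not_less sum.empty zero_less_one)

text \<open>Lower bounds pass to an infimum of reals only if the index set is nonempty: the singleton of least
  mass and the indicator functions provide members for the two infima.\<close>
lemma profile_lower:
  assumes "stat_min V E \<le> r"
    and "\<And>f. \<lbrakk>\<And>x. x \<in> V \<Longrightarrow> f x \<ge> 0; (\<Sum>x | x \<in> V \<and> f x \<noteq> 0. stat V E x) \<le> r\<rbrakk>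
       \<Longrightarrow> c * stat_var V E f \<le> dirichlet_form V E f f"
  shows "c \<le> spectral_profile V E r"
  unfolding spectral_profile_def
proof (intro cINF_greatest)
  obtain x where "x \<in> V" "stat V E x = stat_min V E" using stat_min_attained by auto
  then show "{S. S \<subseteq> V \<and> stat_min V E \<le> (\<Sum>x\<in>S. stat V E x) \<and> (\<Sum>x\<in>S. stat V E x) \<le> r} \<noteq> {}"
    using assms(1) by (auto intro!: exI[of _ "{x}"])
next
  fix S assume S: "S \<in> {S. S \<subseteq> V \<and> stat_min V E \<le> (\<Sum>x\<in>S. stat V E x) \<and> (\<Sum>x\<in>S. stat V E x) \<le> r}"
  then have "S \<noteq> {}" using nonempty_if_mass by blast
  then show "c0_plus V S \<noteq> {}" using indicator_in_c0_plus[of _ S] S by blast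
  fix f assume f: "f \<in> c0_plus V S"
  have "(\<Sum>x | x \<in> V \<and> f x \<noteq> 0. stat V E x) \<le> (\<Sum>x\<in>S. stat V E x)"
    using f S finite_verts stat_pos
    by (intro sum_mono2) (auto simp: c0_plus_def finite_subset intro!: less_imp_le)
  then have "c * stat_var V E f \<le> dirichlet_form V E f f"
    using f S by (intro assms(2)) (auto simp: c0_plus_def)
  then show "c \<le> dirichlet_form V E f f / stat_var V E f"
    using var_pos[of f] f by (simp add: c0_plus_def field_simps)
qed

text \<open>For a test function supported on at most half of the mass, the variance may be replaced by half
  of the second moment, and the factor cancels against the one in the Dirichlet form.\<close>
lemma profile_upper:
  assumes nn: "\<And>x. x \<in> V \<Longrightarrow> f x \<ge> 0" and v: "v \<in> V" "f v \<noteq> 0"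
    and half: "(\<Sum>x | x \<in> V \<and> f x \<noteq> 0. stat V E x) \<le> 1 / 2"
    and r: "(\<Sum>x | x \<in> V \<and> f x \<noteq> 0. stat V E x) \<le> r"
  shows "spectral_profile V E r \<le> edge_energy E f / (\<Sum>(u, v)\<in>E. (f u)\<^sup>2)"
proof -
  let ?S = "{x. x \<in> V \<and> f x \<noteq> 0}" and ?Q = "\<Sum>(u, v)\<in>E. (f u)\<^sup>2"
  let ?SS = "{S. S \<subseteq> V \<and> stat_min V E \<le> (\<Sum>x\<in>S. stat V E x) \<and> (\<Sum>x\<in>S. stat V E x) \<le> r}"
  have nc: "\<not> f constant_on V" using not_constant_if_small_support[OF v(2,1) half] .
  have "stat_min V E \<le> (\<Sum>x\<in>?S. stat V E x)" by (rule stat_min_le_mass) (use v in auto)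
  then have S: "?S \<in> ?SS" using r by blast
  have f: "f \<in> c0_plus V ?S" using nn nc by (auto simp: c0_plus_def)
  have "bdd_below ((\<lambda>S. INF f\<in>c0_plus V S. dirichlet_form V E f f / stat_var V E f) ` ?SS)"
  proof (rule bdd_belowI[of _ 0], clarify)
    fix S assume "S \<subseteq> V" "stat_min V E \<le> (\<Sum>x\<in>S. stat V E x)"
    then have "c0_plus V S \<noteq> {}" using indicator_in_c0_plus[of _ S] nonempty_if_mass by blast
    then show "0 \<le> (INF f\<in>c0_plus V S. dirichlet_form V E f f / stat_var V E f)"
      by (rule cINF_greatest) (simp add: dirichlet_nonneg var_nonneg)
  qed
  then have "spectral_profile V E r \<le> (INF f\<in>c0_plus V ?S. dirichlet_form V E f f / stat_var V E f)"
    unfolding spectral_profile_def using S by (rule cINF_lower)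
  also have "\<dots> \<le> dirichlet_form V E f f / stat_var V E f"
    using f by (intro cINF_lower profile_inner_bdd)
  also have "\<dots> \<le> dirichlet_form V E f f / (?Q / (2 * real (card E)))"
  proof (rule divide_left_mono)
    show 1: "?Q / (2 * real (card E)) \<le> stat_var V E f"
      using var_ge_small_support[OF half] by (simp add: sum_stat)
    obtain w where w: "(v, w) \<in> E" using has_edge v by auto
    have "0 < (f v)\<^sup>2" using v by simp
    also have "\<dots> \<le> ?Q" using member_le_sum[OF w, of "\<lambda>(u, v). (f u)\<^sup>2"] finite_edges by auto
    finally show "0 < stat_var V E f * (?Q / (2 * real (card E)))"
      using edges_nonempty var_pos[OF nc] by simp
  qed (rule dirichlet_nonneg)
  also have "\<dots> = edge_energy E f / ?Q"
    using edges_nonempty by (simp add: dirichlet_energy)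
  finally show ?thesis .
qed

lemma support_mass:
  "(\<Sum>x | x \<in> V \<and> f x \<noteq> 0. stat V E x) = (\<Sum>(u, v)\<in>E. if f u = 0 then 0 else 1) / real (card E)"
proof -
  have "(\<Sum>x | x \<in> V \<and> f x \<noteq> 0. stat V E x) = (\<Sum>x\<in>V. (if f x = 0 then 0 else 1) * stat V E x)"
    by (rule sum.mono_neutral_cong_left) (auto simp: finite_verts)
  then show ?thesis by (simp add: sum_stat)
qed

lemma energy_le_4_sum_sq: "edge_energy E f \<le> 4 * (\<Sum>(u, v)\<in>E. (f u)\<^sup>2)"
proof -
  have *: "(a - b)\<^sup>2 \<le> 2 * a\<^sup>2 + 2 * b\<^sup>2" for a b :: real
    using zero_le_power2[of "a + b"] by (simp add: power2_eq_square algebra_simps)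
  have "edge_energy E f \<le> (\<Sum>(u, v)\<in>E. 2 * (f u)\<^sup>2 + 2 * (f v)\<^sup>2)"
    unfolding edge_energy_def by (rule sum_mono) (auto intro: *)
  also have "\<dots> = 2 * (\<Sum>(u, v)\<in>E. (f u)\<^sup>2) + 2 * (\<Sum>(u, v)\<in>E. (f v)\<^sup>2)"
    by (simp add: sum.distrib sum_distrib_left case_prod_unfold)
  also have "(\<Sum>(u, v)\<in>E. (f v)\<^sup>2) = (\<Sum>(u, v)\<in>E. (f u)\<^sup>2)" by (rule sum_edges_swap)
  finally show ?thesis by simp
qed

end

section \<open>Heat flow and mixing times\<close>

text \<open>Solutions of \<open>\<partial>\<^sub>t u = (K - I) u\<close> on \<open>V\<close>. Since the heat kernel is given by an everywhere
  convergent series, all real times are allowed, so that a flow may also be run backwards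
  (as in \<open>flow_duality\<close>) without restrictions on the time.\<close>
definition heat_flow :: "'v set \<Rightarrow> ('v \<times> 'v) set \<Rightarrow> (real \<Rightarrow> 'v \<Rightarrow> real) \<Rightarrow> bool" where
  "heat_flow V E u \<longleftrightarrow> (\<forall>t. \<forall>x\<in>V.
     ((\<lambda>t. u t x) has_real_derivative ((\<Sum>z\<in>V. srw_kernel E x z * u t z) - u t x)) (at t))"

text \<open>Dividing the inequality by \<open>\<phi>\<^sup>2\<close> shows that \<open>1 / \<phi>\<close> grows at least linearly with slope \<open>c\<close>.\<close>
lemma reciprocal_decay:
  fixes \<phi> \<phi>' :: "real \<Rightarrow> real"
  assumes der: "\<And>t. (\<phi> has_real_derivative \<phi>' t) (at t)"
    and le: "\<And>t. 0 \<le> t \<Longrightarrow> \<phi>' t \<le> - c * (\<phi> t)\<^sup>2"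
    and "c > 0" "T > 0" and nn: "\<And>t. \<phi> t \<ge> 0"
  shows "\<phi> T \<le> 1 / (c * T)"
proof (cases "\<phi> T = 0")
  case False
  then have pos: "\<phi> T > 0" using nn[of T] by simp
  have low: "\<phi> t > 0" if "0 \<le> t" "t \<le> T" for t
  proof -
    have "\<phi> T \<le> \<phi> t"
    proof (rule DERIV_nonpos_imp_nonincreasing[OF that(2)])
      fix x assume "t \<le> x" "x \<le> T"
      moreover have "- c * (\<phi> x)\<^sup>2 \<le> 0" using \<open>c > 0\<close> by simp
      ultimately show "\<exists>y. (\<phi> has_real_derivative y) (at x) \<and> y \<le> 0"
        using der[of x] le[of x] that by (intro exI[of _ "\<phi>' x"]) linarith
    qed
    then show ?thesis using pos by simp
  qed
  have "1 / \<phi> 0 - c * 0 \<le> 1 / \<phi> T - c * T"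
  proof (rule DERIV_nonneg_imp_nondecreasing[of 0 T "\<lambda>t. 1 / \<phi> t - c * t"])
    fix t assume t: "0 \<le> t" "t \<le> T"
    have "((\<lambda>t. 1 / \<phi> t - c * t) has_real_derivative (- \<phi>' t / (\<phi> t)\<^sup>2 - c)) (at t)"
      using low[OF t] by (auto intro!: derivative_eq_intros der simp: power2_eq_square)
    moreover have "- \<phi>' t / (\<phi> t)\<^sup>2 - c \<ge> 0"
      using le[of t] t low[OF t] by (simp add: field_simps)
    ultimately show "\<exists>y. ((\<lambda>t. 1 / \<phi> t - c * t) has_real_derivative y) (at t) \<and> 0 \<le> y" by blast
  qed (use \<open>T > 0\<close> in simp)
  moreover have "1 / \<phi> 0 \<ge> 0" using nn[of 0] by simp
  ultimately have "c * T \<le> 1 / \<phi> T" by linarith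
  then show ?thesis using pos \<open>c > 0\<close> \<open>T > 0\<close> by (simp add: field_simps)
qed (use assms in simp)

context finite_graph
begin

lemma heat_flowD:
  assumes "heat_flow V E u" "x \<in> V"
  shows "((\<lambda>t. u t x) has_real_derivative ((\<Sum>z\<in>V. srw_kernel E x z * u t z) - u t x)) (at t)"
  using assms by (simp add: heat_flow_def)

lemma flow_inner_deriv:
  assumes u: "heat_flow V E u" and w: "heat_flow V E w"
  shows "((\<lambda>t. stat_inner V E (u t) (w t)) has_real_derivative - 2 * dirichlet_form V E (u t) (w t)) (at t)"
proof -
  let ?G = "\<lambda>f x. (\<Sum>z\<in>V. srw_kernel E x z * f z) - f x"
  have "((\<lambda>t. stat_inner V E (u t) (w t)) has_real_derivative
     (\<Sum>x\<in>V. (?G (u t) x * w t x + ?G (w t) x * u t x) * stat V E x)) (at t)"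
    unfolding stat_inner_def
    by (intro DERIV_sum DERIV_cmult_right DERIV_mult heat_flowD[OF u] heat_flowD[OF w])
  moreover have "(\<Sum>x\<in>V. (?G (u t) x * w t x + ?G (w t) x * u t x) * stat V E x)
      = - (dirichlet_form V E (u t) (w t) + dirichlet_form V E (w t) (u t))"
    unfolding dirichlet_form_def stat_inner_def sum.distrib[symmetric] sum_negf[symmetric]
    by (rule sum.cong) (simp_all add: algebra_simps)
  ultimately show ?thesis by (simp add: dirichlet_commute[of "w t"])
qed

text \<open>Because \<open>K\<close> is self-adjoint, the derivative in \<open>s\<close> vanishes. This one identity yields the
  semigroup property, the symmetry of the density and the conservation of the mean.\<close>
lemma flow_duality:
  assumes u: "heat_flow V E u" and w: "heat_flow V E w"
  shows "stat_inner V E (u (t - s)) (w s) = stat_inner V E (u t) (w 0)"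
proof -
  let ?G = "\<lambda>f x. (\<Sum>z\<in>V. srw_kernel E x z * f z) - f x"
  have "((\<lambda>s. stat_inner V E (u (t - s)) (w s)) has_real_derivative 0) (at s)" for s
  proof -
    have m: "((\<lambda>s. t - s) has_real_derivative -1) (at s)" by (auto intro!: derivative_eq_intros)
    have "((\<lambda>s. stat_inner V E (u (t - s)) (w s)) has_real_derivative
      (\<Sum>x\<in>V. (?G (u (t - s)) x * -1 * w s x + ?G (w s) x * u (t - s) x) * stat V E x)) (at s)"
      unfolding stat_inner_def
      by (intro DERIV_sum DERIV_cmult_right DERIV_mult DERIV_chain2[OF heat_flowD[OF u] m] heat_flowD[OF w])
    moreover have "(\<Sum>x\<in>V. (?G (u (t - s)) x * -1 * w s x + ?G (w s) x * u (t - s) x) * stat V E x)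
      = dirichlet_form V E (u (t - s)) (w s) - dirichlet_form V E (w s) (u (t - s))"
      unfolding dirichlet_form_def stat_inner_def sum_subtractf[symmetric]
      by (rule sum.cong) (simp_all add: algebra_simps)
    ultimately show ?thesis by (simp add: dirichlet_commute[of "w s"])
  qed
  then have "stat_inner V E (u (t - s)) (w s) = stat_inner V E (u (t - 0)) (w 0)"
    by (intro DERIV_isconst_all) blast
  then show ?thesis by simp
qed

text \<open>The derivative of the Dirichlet form along the flow is \<open>- 2 \<parallel>(K - I) u\<parallel>\<^sup>2\<close>.\<close>
lemma flow_energy_le:
  assumes u: "heat_flow V E u" and "0 \<le> t"
  shows "dirichlet_form V E (u t) (u t) \<le> dirichlet_form V E (u 0) (u 0)"
proof (rule DERIV_nonpos_imp_nonincreasing[OF \<open>0 \<le> t\<close>, of "\<lambda>t. dirichlet_form V E (u t) (u t)"])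
  fix s :: real
  define g where "g = (\<lambda>x. (\<Sum>z\<in>V. srw_kernel E x z * u s z) - u s x)"
  have "((\<lambda>s. (\<Sum>(x, y)\<in>E. (u s x - u s y) * (u s x - u s y)) / (2 * real (card E))) has_real_derivative
     (\<Sum>(x, y)\<in>E. (g x - g y) * (u s x - u s y) + (g x - g y) * (u s x - u s y)) / (2 * real (card E))) (at s)"
    unfolding case_prod_unfold g_def
    by (intro DERIV_cdivide DERIV_sum DERIV_mult DERIV_diff heat_flowD[OF u]) (auto dest: edge_verts)
  moreover have "(\<Sum>(x, y)\<in>E. (g x - g y) * (u s x - u s y) + (g x - g y) * (u s x - u s y)) / (2 * real (card E))
     = 2 * dirichlet_form V E (u s) g"
    by (simp add: dirichlet_eq sum_distrib_left case_prod_unfold mult.commute)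
  moreover have "dirichlet_form V E (u s) g = - (\<Sum>x\<in>V. (g x)\<^sup>2 * stat V E x)"
    unfolding dirichlet_form_def stat_inner_def sum_negf[symmetric]
    by (rule sum.cong) (simp_all add: g_def power2_eq_square algebra_simps)
  moreover have "(\<Sum>x\<in>V. (g x)\<^sup>2 * stat V E x) \<ge> 0"
    by (intro sum_nonneg mult_nonneg_nonneg) (auto simp: stat_nonneg)
  ultimately show "\<exists>y. ((\<lambda>s. dirichlet_form V E (u s) (u s)) has_real_derivative y) (at s) \<and> y \<le> 0"
    unfolding dirichlet_eq[of "u _" "u _"] by (intro exI[of _ "2 * dirichlet_form V E (u s) g"]) simp
qed

lemma flow_const: "heat_flow V E (\<lambda>t x. c)"
  by (simp add: heat_flow_def sum_distrib_right[symmetric] kernel_row_sum)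

lemma flow_diff:
  assumes "heat_flow V E u" "heat_flow V E w" shows "heat_flow V E (\<lambda>t x. u t x - w t x)"
  using assms unfolding heat_flow_def
  by (auto intro!: derivative_eq_intros simp: sum_subtractf algebra_simps)

lemma flow_cmult:
  assumes "heat_flow V E u" shows "heat_flow V E (\<lambda>t x. u t x * c)"
  using assms unfolding heat_flow_def
  by (auto intro!: derivative_eq_intros simp: sum_distrib_left algebra_simps)

lemma flow_sum:
  assumes "\<And>y. y \<in> V \<Longrightarrow> heat_flow V E (\<lambda>t x. u t x y)"
  shows "heat_flow V E (\<lambda>t x. \<Sum>y\<in>V. u t x y)"
  unfolding heat_flow_def
proof (intro allI ballI)
  fix t x assume x: "x \<in> V"
  have "((\<lambda>t. \<Sum>y\<in>V. u t x y) has_real_derivative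
     (\<Sum>y\<in>V. (\<Sum>z\<in>V. srw_kernel E x z * u t z y) - u t x y)) (at t)"
    by (intro DERIV_sum heat_flowD[OF assms] x)
  moreover have "(\<Sum>y\<in>V. \<Sum>z\<in>V. srw_kernel E x z * u t z y) = (\<Sum>z\<in>V. srw_kernel E x z * (\<Sum>y\<in>V. u t z y))"
    by (subst sum.swap) (simp add: sum_distrib_left)
  ultimately show "((\<lambda>t. \<Sum>y\<in>V. u t x y) has_real_derivative
     (\<Sum>z\<in>V. srw_kernel E x z * (\<Sum>y\<in>V. u t z y)) - (\<Sum>y\<in>V. u t x y)) (at t)"
    by (simp add: sum_subtractf)
qed

lemma kernel_pow_bound: "x \<in> V \<Longrightarrow> \<bar>srw_kernel_pow V E k x y\<bar> \<le> 1"
proof (induction k arbitrary: x)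
  case (Suc k)
  have nn: "srw_kernel E x z \<ge> 0" for z by (simp add: srw_kernel_def)
  have "\<bar>srw_kernel_pow V E (Suc k) x y\<bar> \<le> (\<Sum>z\<in>V. \<bar>srw_kernel E x z * srw_kernel_pow V E k z y\<bar>)"
    by (simp add: sum_abs)
  also have "\<dots> \<le> (\<Sum>z\<in>V. srw_kernel E x z * 1)"
    unfolding abs_mult abs_of_nonneg[OF nn] using nn Suc.IH by (intro sum_mono mult_left_mono)
  finally show ?case using kernel_row_sum[OF Suc.prems] by simp
qed simp

lemma heat_series_summable:
  assumes "x \<in> V" shows "summable (\<lambda>k. srw_kernel_pow V E k x y / fact k * t ^ k)"
proof (rule summable_comparison_test')
  show "summable (\<lambda>k. \<bar>t\<bar> ^ k / fact k)"
    using summable_exp_generic[of "\<bar>t\<bar>"] by (simp add: field_simps)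
  show "norm (srw_kernel_pow V E k x y / fact k * t ^ k) \<le> \<bar>t\<bar> ^ k / fact k" for k
    using kernel_pow_bound[OF assms, of k y]
    by (simp add: abs_mult power_abs divide_right_mono mult_left_le_one_le)
qed

lemma heat_kernel_flow: "heat_flow V E (\<lambda>t x. heat_kernel V E t x y)"
  unfolding heat_flow_def
proof (intro allI ballI)
  fix t :: real and x assume x: "x \<in> V"
  define a where "a z k = srw_kernel_pow V E k z y / fact k" for z k
  have sm: "summable (\<lambda>k. a z k * t ^ k)" if "z \<in> V" for z t
    unfolding a_def by (rule heat_series_summable[OF that])
  have hk: "heat_kernel V E t z y = exp (- t) * (\<Sum>k. a z k * t ^ k)" for t z
    by (simp add: heat_kernel_def a_def mult.commute)
  have "((\<lambda>t. \<Sum>k. a x k * t ^ k) has_real_derivative (\<Sum>k. diffs (a x) k * t ^ k)) (at t)"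
    by (rule termdiffs_strong_converges_everywhere) (rule sm[OF x])
  moreover have "diffs (a x) k * t ^ k = (\<Sum>z\<in>V. srw_kernel E x z * (a z k * t ^ k))" for k
  proof -
    have "diffs (a x) k = (\<Sum>z\<in>V. srw_kernel E x z * srw_kernel_pow V E k z y) / fact k"
      by (simp add: diffs_def a_def)
    then show ?thesis by (simp add: a_def sum_divide_distrib sum_distrib_right mult.assoc)
  qed
  moreover have "(\<Sum>k. \<Sum>z\<in>V. srw_kernel E x z * (a z k * t ^ k)) = (\<Sum>z\<in>V. srw_kernel E x z * (\<Sum>k. a z k * t ^ k))"
    using sm by (subst suminf_sum) (auto intro!: summable_mult sum.cong suminf_mult)
  ultimately have "((\<lambda>t. \<Sum>k. a x k * t ^ k) has_real_derivative
      (\<Sum>z\<in>V. srw_kernel E x z * (\<Sum>k. a z k * t ^ k))) (at t)" by simp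
  then have "((\<lambda>t. exp (- t) * (\<Sum>k. a x k * t ^ k)) has_real_derivative
      - exp (- t) * (\<Sum>k. a x k * t ^ k) + (\<Sum>z\<in>V. srw_kernel E x z * (\<Sum>k. a z k * t ^ k)) * exp (- t)) (at t)"
    by (intro DERIV_mult) (auto intro!: derivative_eq_intros)
  then show "((\<lambda>t. heat_kernel V E t x y) has_real_derivative
     (\<Sum>z\<in>V. srw_kernel E x z * heat_kernel V E t z y) - heat_kernel V E t x y) (at t)"
    by (simp add: hk sum_distrib_right sum_distrib_left algebra_simps)
qed

lemma heat_kernel_0: "heat_kernel V E 0 x y = (if x = y then 1 else 0)"
proof -
  have eq: "(\<Sum>k. (0::real) ^ k / fact k * srw_kernel_pow V E k x y)
      = (\<Sum>k. (srw_kernel_pow V E k x y / fact k) * 0 ^ k)" by (simp add: mult.commute)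
  show ?thesis unfolding heat_kernel_def eq powser_zero by simp
qed

lemma density_flow: "heat_flow V E (\<lambda>t z. heat_kernel V E t z x / stat V E x)"
  using flow_cmult[OF heat_kernel_flow, of x "1 / stat V E x"] by simp

lemma inner_delta:
  assumes "y \<in> V"
  shows "stat_inner V E f (\<lambda>z. heat_kernel V E 0 z y / stat V E y) = f y"
proof -
  have "stat_inner V E f (\<lambda>z. heat_kernel V E 0 z y / stat V E y) = (\<Sum>z\<in>V. if z = y then f z else 0)"
    unfolding stat_inner_def by (rule sum.cong) (use stat_pos[OF assms] in \<open>auto simp: heat_kernel_0\<close>)
  then show ?thesis using finite_verts assms by simp
qed

text \<open>Duality between the flows started from the normalised point masses at \<open>x\<close> and \<open>y\<close>.\<close>
lemma density_inner:
  assumes "y \<in> V"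
  shows "stat_inner V E (\<lambda>z. heat_kernel V E (t - s) z x / stat V E x) (\<lambda>z. heat_kernel V E s z y / stat V E y)
     = heat_kernel V E t y x / stat V E x"
  using flow_duality[OF density_flow density_flow, of t s x y] inner_delta[OF assms] by simp

lemma stat_inner_commute: "stat_inner V E f g = stat_inner V E g f"
  by (simp add: stat_inner_def mult.commute)

lemma density_sym:
  assumes "x \<in> V" "y \<in> V"
  shows "heat_kernel V E t x y / stat V E y = heat_kernel V E t y x / stat V E x"
  using density_inner[OF assms(2), of t 0 x] density_inner[OF assms(1), of t t y]
  by (simp add: stat_inner_commute)

lemma flow_mean:
  assumes "heat_flow V E u" shows "stat_mean V E (u t) = stat_mean V E (u 0)"
  using flow_duality[OF assms flow_const[of 1], of t t] by (simp add: stat_inner_def stat_mean_def)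

lemma density_mean: assumes "x \<in> V" shows "stat_mean V E (\<lambda>z. heat_kernel V E t z x / stat V E x) = 1"
proof -
  have "stat_mean V E (\<lambda>z. heat_kernel V E t z x / stat V E x)
      = stat_mean V E (\<lambda>z. heat_kernel V E 0 z x / stat V E x)"
    by (rule flow_mean[OF density_flow])
  also have "\<dots> = stat_inner V E (\<lambda>_. 1) (\<lambda>z. heat_kernel V E 0 z x / stat V E x)"
    by (simp add: stat_mean_def stat_inner_def)
  finally show ?thesis using inner_delta[OF assms, of "\<lambda>_. 1"] by simp
qed

text \<open>On the diagonal, the squared \<open>L\<^sup>2\<close> distance to equilibrium at time \<open>t\<close> is the pointwise excess
  of the density at time \<open>2 t\<close>.\<close>
lemma density_centred_inner:
  assumes x: "x \<in> V" and y: "y \<in> V"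
  shows "stat_inner V E (\<lambda>z. heat_kernel V E t z x / stat V E x - 1) (\<lambda>z. heat_kernel V E t z y / stat V E y - 1)
    = heat_kernel V E (2 * t) x y / stat V E y - 1"
proof -
  let ?f = "\<lambda>x z. heat_kernel V E t z x / stat V E x"
  have "stat_inner V E (\<lambda>z. ?f x z - 1) (\<lambda>z. ?f y z - 1)
     = stat_inner V E (?f x) (?f y) - stat_mean V E (?f x) - stat_mean V E (?f y) + (\<Sum>z\<in>V. stat V E z)"
    unfolding stat_inner_def stat_mean_def sum_subtractf[symmetric] sum.distrib[symmetric]
    by (rule sum.cong) (simp_all add: algebra_simps)
  then show ?thesis
    using density_inner[OF y, of "2 * t" t x] density_sym[OF x y, of "2 * t"]
    by (simp add: density_mean x y sum_stat_1)
qed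

lemma lp_norm_infinity_le: "lp_norm V E \<infinity> f \<le> c \<longleftrightarrow> (\<forall>x\<in>V. \<bar>f x\<bar> \<le> c)"
proof -
  have "{\<bar>f x\<bar> | x. x \<in> V \<and> stat V E x > 0} = (\<lambda>x. \<bar>f x\<bar>) ` V" using stat_pos by auto
  then show ?thesis using finite_verts verts_nonempty by (simp add: lp_norm_def)
qed

lemma lp_norm_1: "lp_norm V E 1 f = (\<Sum>x\<in>V. \<bar>f x\<bar> * stat V E x)"
  using sum_nonneg[of V "\<lambda>x. \<bar>f x\<bar> * stat V E x"] by (simp add: lp_norm_def stat_nonneg)

lemma lp_norm_1_le_infinity: "lp_norm V E \<infinity> f \<le> c \<Longrightarrow> lp_norm V E 1 f \<le> c"
proof -
  assume "lp_norm V E \<infinity> f \<le> c"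
  then have "(\<Sum>x\<in>V. \<bar>f x\<bar> * stat V E x) \<le> (\<Sum>x\<in>V. c * stat V E x)"
    unfolding lp_norm_infinity_le by (intro sum_mono mult_right_mono) (auto simp: stat_nonneg)
  then show ?thesis by (simp add: lp_norm_1 sum_distrib_left[symmetric] sum_stat_1)
qed

lemma mixing_time_eq:
  "mixing_time V E p \<epsilon> = Inf {ereal t | t. t > 0 \<and>
     (\<forall>x\<in>V. lp_norm V E p (\<lambda>y. heat_kernel V E t x y / stat V E y - 1) \<le> \<epsilon>)}"
  using finite_verts verts_nonempty by (simp add: mixing_time_def)

lemma mixing_time_1_le_infinity: "mixing_time V E 1 \<epsilon> \<le> mixing_time V E \<infinity> \<epsilon>"
  unfolding mixing_time_eq by (rule Inf_superset_mono) (use lp_norm_1_le_infinity in blast)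

text \<open>The return excess \<open>\<phi>(t/2)\<close> is the value at \<open>x\<close> of a function that is nonpositive somewhere,
  so its square is at most \<open>R\<close> times the energy, which is the rate of decrease of \<open>\<phi>\<close> up to
  \<open>|E|\<close>. As \<open>\<phi>\<close> decreases, \<open>\<phi>' \<le> - \<phi>\<^sup>2 / (R |E|)\<close> follows, and \<open>reciprocal_decay\<close> applies.\<close>
lemma mixing_time_infinity_le:
  assumes "R > 0"
    and osc: "\<And>f x y. x \<in> V \<Longrightarrow> y \<in> V \<Longrightarrow> (f x - f y)\<^sup>2 \<le> R * edge_energy E f"
  shows "mixing_time V E \<infinity> (1 / exp 1) \<le> ereal (2 * exp 1 * R * real (card E))"
proof -
  define T where "T = 2 * exp 1 * R * real (card E)"
  have Tpos: "T > 0" using \<open>R > 0\<close> edges_nonempty by (simp add: T_def)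
  define h where "h x t = (\<lambda>z. heat_kernel V E t z x / stat V E x - 1)" for x t
  define \<phi> where "\<phi> x t = stat_inner V E (h x t) (h x t)" for x t
  have flow: "heat_flow V E (h x)" for x
    unfolding h_def by (rule flow_diff[OF density_flow flow_const])
  have inner: "stat_inner V E (h x t) (h y t) = heat_kernel V E (2 * t) x y / stat V E y - 1"
    if "x \<in> V" "y \<in> V" for x y t
    unfolding h_def by (rule density_centred_inner[OF that])
  have \<phi>_nonneg: "\<phi> x t \<ge> 0" for x t
    unfolding \<phi>_def stat_inner_def by (intro sum_nonneg) (simp add: stat_nonneg)
  have \<phi>_deriv: "(\<phi> x has_real_derivative - edge_energy E (h x t) / real (card E)) (at t)" for x t
    using flow_inner_deriv[OF flow flow, of x x t] by (simp add: \<phi>_def[abs_def] dirichlet_energy)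
  \<comment> \<open>At time \<open>T / 2\<close> the bound \<open>2 R |E| / T\<close> from the decay is exactly \<open>1 / exp 1\<close>.\<close>
  have decay: "\<phi> x (T / 2) \<le> 1 / exp 1" if x: "x \<in> V" for x
  proof -
    have "- edge_energy E (h x t) / real (card E) \<le> - (1 / (R * real (card E))) * (\<phi> x t)\<^sup>2"
      if t: "0 \<le> t" for t
    proof -
      have diag: "h x t x = \<phi> x (t / 2)"
        using inner[OF x x, of "t / 2"] by (simp add: \<phi>_def h_def)
      have "\<phi> x t \<le> \<phi> x (t / 2)"
      proof (rule DERIV_nonpos_imp_nonincreasing[of "t / 2" t])
        show "\<exists>y. (\<phi> x has_real_derivative y) (at s) \<and> y \<le> 0" for s
          using \<phi>_deriv[of x s] by (intro exI conjI) (auto simp: edge_energy_nonneg)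
      qed (use t in simp)
      then have 1: "(\<phi> x t)\<^sup>2 \<le> (h x t x)\<^sup>2" using \<phi>_nonneg diag by (simp add: power_mono)
      have "\<exists>y\<in>V. h x t y \<le> 0"
      proof (rule ccontr)
        assume "\<not> ?thesis"
        then have "0 < (\<Sum>y\<in>V. h x t y * stat V E y)"
          using finite_verts verts_nonempty stat_pos by (intro sum_pos) auto
        also have "\<dots> = stat_mean V E (\<lambda>z. heat_kernel V E t z x / stat V E x) - (\<Sum>y\<in>V. stat V E y)"
          unfolding stat_mean_def sum_subtractf[symmetric] h_def by (simp add: algebra_simps)
        finally show False by (simp add: density_mean x sum_stat_1)
      qed
      then obtain y where y: "y \<in> V" "h x t y \<le> 0" by auto
      have "(h x t x)\<^sup>2 \<le> (h x t x - h x t y)\<^sup>2"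
        using diag \<phi>_nonneg[of x "t / 2"] y(2) by (intro power_mono) auto
      also have "\<dots> \<le> R * edge_energy E (h x t)" by (rule osc[OF x y(1)])
      finally have "(\<phi> x t)\<^sup>2 \<le> R * edge_energy E (h x t)" using 1 by simp
      then show ?thesis using \<open>R > 0\<close> edges_nonempty by (simp add: field_simps)
    qed
    then have "\<phi> x (T / 2) \<le> 1 / (1 / (R * real (card E)) * (T / 2))"
      using \<phi>_deriv \<phi>_nonneg \<open>R > 0\<close> edges_nonempty Tpos
      by (intro reciprocal_decay[where \<phi>' = "\<lambda>t. - edge_energy E (h x t) / real (card E)"]) auto
    then show ?thesis using \<open>R > 0\<close> edges_nonempty by (simp add: T_def)
  qed
  have "\<bar>heat_kernel V E T x y / stat V E y - 1\<bar> \<le> 1 / exp 1" if x: "x \<in> V" and y: "y \<in> V" for x y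
  proof -
    have ab: "\<bar>a * b\<bar> \<le> (a * a + b * b) / 2" for a b :: real
      using sum_squares_bound[of "\<bar>a\<bar>" "\<bar>b\<bar>"] by (simp add: abs_mult power2_eq_square)
    have "heat_kernel V E T x y / stat V E y - 1 = stat_inner V E (h x (T / 2)) (h y (T / 2))"
      using inner[OF x y, of "T / 2"] by simp
    also have "\<bar>\<dots>\<bar> \<le> (\<Sum>z\<in>V. \<bar>h x (T / 2) z * h y (T / 2) z\<bar> * stat V E z)"
      unfolding stat_inner_def
      by (rule order_trans[OF sum_abs]) (simp add: abs_mult[of _ "stat _ _ _"] stat_nonneg)
    also have "\<dots> \<le> (\<Sum>z\<in>V. (h x (T / 2) z * h x (T / 2) z + h y (T / 2) z * h y (T / 2) z) / 2 * stat V E z)"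
      by (intro sum_mono mult_right_mono ab stat_nonneg)
    also have "\<dots> = (\<phi> x (T / 2) + \<phi> y (T / 2)) / 2"
      by (simp add: \<phi>_def stat_inner_def sum.distrib[symmetric] sum_divide_distrib distrib_right add_divide_distrib)
    also have "\<dots> \<le> 1 / exp 1"
      using add_mono[OF decay[OF x] decay[OF y]] by simp
    finally show ?thesis .
  qed
  then show ?thesis
    unfolding mixing_time_eq T_def[symmetric] lp_norm_infinity_le using Tpos
    by (intro Inf_lower) blast
qed

text \<open>If the walk is mixed at time \<open>t\<close>, then \<open>H\<^sub>t f\<close> deviates from its mean by at most
  \<open>1 / (2 e) \<le> 1 / 4\<close>: subtracting \<open>1 / 2\<close> from \<open>f\<close> halves its sup norm. The variance has thus
  dropped from at least \<open>1 / 12\<close> to at most \<open>1 / 16\<close>, while it cannot drop faster than at the rate given by the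
  initial energy.\<close>
lemma mixing_time_1_ge:
  assumes f01: "\<And>x. x \<in> V \<Longrightarrow> 0 \<le> f x \<and> f x \<le> 1"
    and var: "\<And>c. real (card E) / 12 \<le> (\<Sum>(u, v)\<in>E. (f u - c)\<^sup>2)"
    and en: "edge_energy E f \<le> e" "e > 0"
  shows "ereal (real (card E) / (48 * e)) \<le> mixing_time V E 1 (1 / exp 1)"
  unfolding mixing_time_eq
proof (rule Inf_greatest, clarify)
  fix t :: real
  assume t: "t > 0" and mix: "\<forall>x\<in>V. lp_norm V E 1 (\<lambda>y. heat_kernel V E t x y / stat V E y - 1) \<le> 1 / exp 1"
  define u where "u t x = (\<Sum>y\<in>V. heat_kernel V E t x y * f y)" for t x
  have flow: "heat_flow V E u"
    unfolding u_def[abs_def] by (rule flow_sum) (rule flow_cmult[OF heat_kernel_flow])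
  have u0: "u 0 x = f x" if "x \<in> V" for x
    using that finite_verts by (simp add: u_def heat_kernel_0 if_distrib[of "\<lambda>a. a * _"] cong: if_cong)
  define m where "m = stat_mean V E f"
  have mean: "stat_mean V E (u s) = m" for s
  proof -
    have "stat_mean V E (u s) = stat_mean V E (u 0)" by (rule flow_mean[OF flow])
    also have "\<dots> = m" unfolding m_def stat_mean_def by (rule sum.cong) (simp_all add: u0)
    finally show ?thesis .
  qed
  have close: "\<bar>u t x - m\<bar> \<le> 1 / 4" if x: "x \<in> V" for x
  proof -
    define h where "h y = (heat_kernel V E t x y / stat V E y - 1) * stat V E y" for y
    have h: "h y = heat_kernel V E t x y - stat V E y" if "y \<in> V" for y
      using stat_pos[OF that] by (simp add: h_def field_simps)
    have "(\<Sum>y\<in>V. heat_kernel V E t x y) = (\<Sum>y\<in>V. (heat_kernel V E t x y / stat V E y) * stat V E y)"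
      by (rule sum.cong) (use stat_pos in force)+
    also have "\<dots> = (\<Sum>y\<in>V. (heat_kernel V E t y x / stat V E x) * stat V E y)"
      by (rule sum.cong) (simp_all add: density_sym[OF x])
    also have "\<dots> = 1" using density_mean[OF x, of t] by (simp add: stat_mean_def)
    finally have "(\<Sum>y\<in>V. h y) = 0" by (simp add: h sum_subtractf sum_stat_1)
    moreover have "(\<Sum>y\<in>V. h y * (f y - 1 / 2)) = (\<Sum>y\<in>V. h y * f y) - (\<Sum>y\<in>V. h y) * (1 / 2)"
      by (simp add: right_diff_distrib sum_subtractf sum_distrib_right)
    moreover have "(\<Sum>y\<in>V. h y * f y) = u t x - m"
      by (simp add: u_def m_def stat_mean_def sum_subtractf[symmetric] h algebra_simps)
    ultimately have "u t x - m = (\<Sum>y\<in>V. h y * (f y - 1 / 2))" by simp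
    also have "\<bar>\<dots>\<bar> \<le> (\<Sum>y\<in>V. \<bar>h y * (f y - 1 / 2)\<bar>)" by (rule sum_abs)
    also have "\<dots> \<le> (\<Sum>y\<in>V. \<bar>h y\<bar> * (1 / 2))"
    proof -
      have "\<bar>f y - 1 / 2\<bar> \<le> 1 / 2" if "y \<in> V" for y using f01[OF that] by linarith
      then show ?thesis unfolding abs_mult by (intro sum_mono mult_left_mono) auto
    qed
    also have "\<dots> = lp_norm V E 1 (\<lambda>y. heat_kernel V E t x y / stat V E y - 1) / 2"
      by (simp add: lp_norm_1 h_def abs_mult stat_nonneg sum_divide_distrib)
    also have "\<dots> \<le> 1 / exp 1 / 2" using mix x by (intro divide_right_mono) auto
    also have "\<dots> \<le> 1 / 4"
      using exp_ge_add_one_self[of 1] by (simp add: field_simps)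
    finally show ?thesis .
  qed
  have "stat_var V E (u t) \<le> (\<Sum>x\<in>V. (u t x - m)\<^sup>2 * stat V E x)" by (rule var_le_sum_sq)
  also have "\<dots> \<le> (\<Sum>x\<in>V. (1 / 4)\<^sup>2 * stat V E x)"
    using close by (intro sum_mono mult_right_mono stat_nonneg) (metis abs_ge_zero power2_abs power_mono)
  also have "\<dots> = 1 / 16" unfolding sum_distrib_left[symmetric] sum_stat_1 by (simp add: power2_eq_square)
  finally have upper: "stat_var V E (u t) \<le> 1 / 16" .
  have "stat_var V E (u 0) = (\<Sum>(x, y)\<in>E. (f x - m)\<^sup>2) / real (card E)"
    unfolding stat_var_def mean sum_stat by (auto intro!: sum.cong simp: u0 dest: edge_verts)
  also have "\<dots> \<ge> 1 / 12" using var[of m] edges_nonempty by (simp add: field_simps)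
  finally have lower: "1 / 12 \<le> stat_var V E (u 0)" .
  have vi: "stat_var V E (u s) = stat_inner V E (u s) (u s) - m\<^sup>2" for s
    by (simp add: var_eq mean stat_inner_def power2_eq_square)
  have E0: "dirichlet_form V E (u 0) (u 0) \<le> e / (2 * real (card E))"
  proof -
    have "edge_energy E (u 0) = edge_energy E f"
      unfolding edge_energy_def
      by (rule sum.cong) (auto simp: u0[OF edge_verts(1)] u0[OF edge_verts(2)])
    then show ?thesis using en by (simp add: dirichlet_energy divide_right_mono)
  qed
  have "stat_inner V E (u 0) (u 0) + e / real (card E) * 0 \<le> stat_inner V E (u t) (u t) + e / real (card E) * t"
  proof (rule DERIV_nonneg_imp_nondecreasing[of 0 t
        "\<lambda>s. stat_inner V E (u s) (u s) + e / real (card E) * s"])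
    fix s :: real assume s: "0 \<le> s"
    have "((\<lambda>s. stat_inner V E (u s) (u s) + e / real (card E) * s) has_real_derivative
        (- 2 * dirichlet_form V E (u s) (u s) + e / real (card E))) (at s)"
      by (intro DERIV_add flow_inner_deriv flow DERIV_cmult_Id)
    moreover have "0 \<le> - 2 * dirichlet_form V E (u s) (u s) + e / real (card E)"
      using flow_energy_le[OF flow s] E0 by simp
    ultimately show "\<exists>y. ((\<lambda>s. stat_inner V E (u s) (u s) + e / real (card E) * s) has_real_derivative y) (at s) \<and> 0 \<le> y"
      by blast
  qed (use t in simp)
  then have "1 / 48 \<le> e / real (card E) * t" using upper lower vi[of 0] vi[of t] by linarith
  then show "ereal (real (card E) / (48 * e)) \<le> ereal t"
    using en(2) edges_nonempty by (simp add: field_simps)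
qed

end

section \<open>Graph distances and gluing\<close>

lemma graph_dist_le: "(u, v) \<in> E ^^ k \<Longrightarrow> graph_dist E u v \<le> k"
  unfolding graph_dist_def by (rule Least_le)

text \<open>Distances are bounded below by exhibiting functions that grow by at most one along each edge.\<close>
lemma lipschitz_along_path:
  fixes g :: "'v \<Rightarrow> int"
  assumes "\<And>u v. (u, v) \<in> E \<Longrightarrow> g v \<le> g u + 1" "(u, v) \<in> E ^^ k"
  shows "g v \<le> g u + int k"
  using assms(2)
proof (induction k arbitrary: v)
  case (Suc k)
  then obtain w where "(u, w) \<in> E ^^ k" "(w, v) \<in> E" by auto
  then show ?case using Suc.IH[of w] assms(1)[of w v] by simp
qed simp

context finite_graph
begin

lemma dist_path: assumes "u \<in> V" "v \<in> V" shows "(u, v) \<in> E ^^ graph_dist E u v"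
proof -
  obtain k where "(u, v) \<in> E ^^ k" using connected[OF assms] rtrancl_imp_relpow by metis
  then show ?thesis unfolding graph_dist_def by (rule LeastI)
qed

lemma dist_triangle:
  assumes "u \<in> V" "v \<in> V" "w \<in> V" shows "graph_dist E u w \<le> graph_dist E u v + graph_dist E v w"
proof (rule graph_dist_le)
  show "(u, w) \<in> E ^^ (graph_dist E u v + graph_dist E v w)"
    unfolding relpow_add using dist_path assms by blast
qed

lemma dist_self: "graph_dist E u u = 0"
  using graph_dist_le[where k = 0 and E = E] by simp

lemma dist_edge: "(u, v) \<in> E \<Longrightarrow> graph_dist E u v \<le> 1"
  using graph_dist_le[where k = 1 and E = E] by simp

lemma dist_step: assumes "a \<in> V" "(u, v) \<in> E" shows "graph_dist E a v \<le> graph_dist E a u + 1"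
  using dist_triangle[of a u v] dist_edge[OF assms(2)] assms edge_verts by fastforce

lemma finite_dists: "finite {graph_dist E u v | u v. u \<in> V \<and> v \<in> V}"
proof -
  have "{graph_dist E u v | u v. u \<in> V \<and> v \<in> V} = (\<lambda>(u, v). graph_dist E u v) ` (V \<times> V)" by auto
  then show ?thesis using finite_verts by simp
qed

lemma dist_le_diam: "u \<in> V \<Longrightarrow> v \<in> V \<Longrightarrow> graph_dist E u v \<le> graph_diam V E"
  unfolding graph_diam_def by (rule Max_ge[OF finite_dists]) auto

lemma diam_eqI:
  assumes "\<And>u v. u \<in> V \<Longrightarrow> v \<in> V \<Longrightarrow> graph_dist E u v \<le> D"
    and "a \<in> V" "b \<in> V" "graph_dist E a b \<ge> D"
  shows "graph_diam V E = D"
proof -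
  have "graph_dist E a b = D" using assms by (meson le_antisym)
  then show ?thesis unfolding graph_diam_def by (intro Max_eqI finite_dists) (use assms in auto)
qed

lemma dist_ge_lipschitz:
  assumes "\<And>u v. (u, v) \<in> E \<Longrightarrow> g v \<le> g u + 1" "u \<in> V" "v \<in> V"
  shows "g v - g u \<le> int (graph_dist E u v)"
  using lipschitz_along_path[of E g, OF assms(1) dist_path[OF assms(2,3)]] by simp

end

text \<open>Every vertex at which a graph is glued to others at the next level is of this kind.\<close>
definition extremal :: "'v set \<Rightarrow> ('v \<times> 'v) set \<Rightarrow> 'v \<Rightarrow> bool" where
  "extremal V E v \<longleftrightarrow> v \<in> V \<and> (\<exists>w\<in>V. graph_dist E v w = graph_diam V E)"

lemma copy_vert_glued: "1 \<le> i \<Longrightarrow> copy_vert x i (x i) = copy_vert x 0 (x i)"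
  by (simp add: copy_vert_def)

lemma copy_vert_inj: "inj (copy_vert x i)"
  by (rule injI) (auto simp: copy_vert_def split: if_splits)

text \<open>The vertex \<open>0 # x i\<close> is read in the central copy. A family of functions on the copies is thus
  recovered from the glued function if its members agree at the gluing points.\<close>
definition glued :: "(nat \<Rightarrow> nat list \<Rightarrow> 'a) \<Rightarrow> nat list \<Rightarrow> 'a" where
  "glued F w = F (hd w) (tl w)"

lemma glued_copy:
  assumes "1 \<le> i \<Longrightarrow> F i (x i) = F 0 (x i)" shows "glued F (copy_vert x i v) = F i v"
  using assms by (auto simp: glued_def copy_vert_def)

lemma glue_verts_cases:
  assumes "w \<in> glue_verts N x V" obtains i v where "i \<le> N" "v \<in> V" "w = copy_vert x i v"
  using assms by (auto simp: glue_verts_def)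

lemma glue_verts_I: "i \<le> N \<Longrightarrow> v \<in> V \<Longrightarrow> copy_vert x i v \<in> glue_verts N x V"
  by (auto simp: glue_verts_def)

lemma glue_edges_cases:
  assumes "(a, b) \<in> glue_edges N x E"
  obtains i u v where "i \<le> N" "(u, v) \<in> E" "a = copy_vert x i u" "b = copy_vert x i v"
  using assms by (auto simp: glue_edges_def)

lemma glue_edges_I: "i \<le> N \<Longrightarrow> (u, v) \<in> E \<Longrightarrow> (copy_vert x i u, copy_vert x i v) \<in> glue_edges N x E"
  by (force simp: glue_edges_def)

locale gluing = finite_graph V E for V :: "nat list set" and E :: "(nat list \<times> nat list) set" +
  fixes N :: nat and x :: "nat \<Rightarrow> nat list"
  assumes N_ge_2: "N \<ge> 2"
    and corner_in: "\<And>i. 1 \<le> i \<Longrightarrow> i \<le> N \<Longrightarrow> x i \<in> V"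
    and corner_dist: "\<And>i j. 1 \<le> i \<Longrightarrow> i \<le> N \<Longrightarrow> 1 \<le> j \<Longrightarrow> j \<le> N \<Longrightarrow> i \<noteq> j \<Longrightarrow>
       graph_dist E (x i) (x j) = graph_diam V E"
begin

abbreviation "c \<equiv> copy_vert x"
abbreviation "V' \<equiv> glue_verts N x V"
abbreviation "E' \<equiv> glue_edges N x E"

text \<open>The copies share vertices but no edges: of the two distinct end vertices of an edge in copy
  \<open>i\<close>, at most one is a gluing point, so the other one still carries the label \<open>i\<close>.\<close>
lemma sum_glue: "(\<Sum>(u, v)\<in>E'. g u v) = (\<Sum>i\<le>N. \<Sum>(u, v)\<in>E. g (c i u) (c i v))"
proof -
  have disj: "map_prod (c i) (c i) ` E \<inter> map_prod (c j) (c j) ` E = {}" if "i \<noteq> j" for i j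
  proof -
    have *: "i = 0 \<or> i = j" if "(u, v) \<in> E" "c i u = c j u'" "c i v = c j v'" for u v u' v' i j
    proof -
      have "u \<noteq> v" using that irrefl_edges by (auto simp: irrefl_def)
      then have "hd (c i u) = i \<or> hd (c i v) = i" by (auto simp: copy_vert_def)
      moreover have "hd (c j w) \<in> {0, j}" for w by (auto simp: copy_vert_def)
      ultimately show ?thesis using that by (metis empty_iff insert_iff)
    qed
    show ?thesis
    proof (rule ccontr)
      assume "\<not> ?thesis"
      then obtain u v u' v' where "(u, v) \<in> E" "(u', v') \<in> E" "c i u = c j u'" "c i v = c j v'" by auto
      then show False using *[of u v i j u' v'] *[of u' v' j i u v] that by auto
    qed
  qed
  have "(\<Sum>(u, v)\<in>E'. g u v) = (\<Sum>i\<le>N. \<Sum>(u, v)\<in>map_prod (c i) (c i) ` E. g u v)"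
    unfolding glue_edges_def using finite_edges disj by (intro sum.UNION_disjoint) auto
  also have "\<dots> = (\<Sum>i\<le>N. \<Sum>(u, v)\<in>E. g (c i u) (c i v))"
  proof (rule sum.cong[OF refl])
    fix i
    have "inj_on (map_prod (c i) (c i)) E"
      by (rule inj_on_subset[OF _ subset_UNIV]) (intro prod.inj_map copy_vert_inj)
    then show "(\<Sum>(u, v)\<in>map_prod (c i) (c i) ` E. g u v) = (\<Sum>(u, v)\<in>E. g (c i u) (c i v))"
      by (subst sum.reindex) (auto simp: case_prod_unfold)
  qed
  finally show ?thesis .
qed

lemma energy_glue: "edge_energy E' f = (\<Sum>i\<le>N. edge_energy E (\<lambda>v. f (c i v)))"
  unfolding edge_energy_def by (rule sum_glue)

lemma card_glue_edges: "card E' = (N + 1) * card E"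
  using sum_glue[of "\<lambda>u v. 1 :: nat"] by (simp add: case_prod_unfold)

lemma path_copy: "i \<le> N \<Longrightarrow> (u, v) \<in> E ^^ k \<Longrightarrow> (c i u, c i v) \<in> E' ^^ k"
proof (induction k arbitrary: v)
  case (Suc k)
  then obtain w where w: "(u, w) \<in> E ^^ k" "(w, v) \<in> E" by auto
  show ?case
    by (rule relpow_Suc_I[OF Suc.IH[OF Suc.prems(1) w(1)] glue_edges_I[OF Suc.prems(1) w(2)]])
qed simp

lemma reach_copy: assumes "i \<le> N" "u \<in> V" "v \<in> V" shows "(c i u, c i v) \<in> E'\<^sup>*"
  using path_copy[OF assms(1) dist_path[OF assms(2,3)]] by (rule relpow_imp_rtrancl)

lemma reach_gate: assumes "i \<le> N" "u \<in> V" "w \<in> V"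
  shows "(c i u, c 0 w) \<in> E'\<^sup>*" "(c 0 w, c i u) \<in> E'\<^sup>*"
proof -
  have "(c i u, c 0 w) \<in> E'\<^sup>* \<and> (c 0 w, c i u) \<in> E'\<^sup>*"
  proof (cases "1 \<le> i")
    case True
    have x: "x i \<in> V" using corner_in True assms by simp
    show ?thesis
      using reach_copy[OF assms(1,2) x] reach_copy[OF assms(1) x assms(2)]
        reach_copy[OF le0 x assms(3)] reach_copy[OF le0 assms(3) x]
      unfolding copy_vert_glued[OF True] by (meson rtrancl_trans)
  next
    case False
    then have "i = 0" by simp
    then show ?thesis using reach_copy assms by auto
  qed
  then show "(c i u, c 0 w) \<in> E'\<^sup>*" "(c 0 w, c i u) \<in> E'\<^sup>*" by auto
qed

lemma finite_graph_glue: "finite_graph V' E'"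
proof
  show "finite V'" using finite_verts by (simp add: glue_verts_def)
  show "V' \<noteq> {}" using verts_nonempty by (auto simp: glue_verts_def)
  show "E' \<subseteq> V' \<times> V'" by (auto elim!: glue_edges_cases intro!: glue_verts_I dest: edge_verts)
  show "sym E'" using sym_edges by (auto intro!: symI elim!: glue_edges_cases intro: glue_edges_I dest: symD)
  show "irrefl E'"
    using irrefl_edges by (auto simp: irrefl_def elim!: glue_edges_cases dest!: injD[OF copy_vert_inj])
  show "\<exists>b. (a, b) \<in> E'" if "a \<in> V'" for a
    using that has_edge by (metis glue_verts_cases glue_edges_I)
  obtain w where w: "w \<in> V" using verts_nonempty by auto
  show "(a, b) \<in> E'\<^sup>*" if a: "a \<in> V'" and b: "b \<in> V'" for a b
  proof -
    obtain i u j v where "i \<le> N" "u \<in> V" "a = c i u" "j \<le> N" "v \<in> V" "b = c j v"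
      using a b by (metis glue_verts_cases)
    then show ?thesis using reach_gate(1)[of i u w] reach_gate(2)[of j v w] w by (meson rtrancl_trans)
  qed
qed

sublocale glue: finite_graph V' E' by (rule finite_graph_glue)

abbreviation "dist' \<equiv> graph_dist E'"
abbreviation "D \<equiv> graph_diam V E"

lemma dist_same_copy:
  assumes "i \<le> N" "u \<in> V" "v \<in> V" shows "dist' (c i u) (c i v) \<le> graph_dist E u v"
  by (rule graph_dist_le) (rule path_copy[OF assms(1) dist_path[OF assms(2,3)]])

lemma dist_to_centre:
  assumes i: "1 \<le> i" "i \<le> N" and "u \<in> V" "v \<in> V"
  shows "dist' (c i u) (c 0 v) \<le> graph_dist E u (x i) + graph_dist E (x i) v"
    and "dist' (c 0 v) (c i u) \<le> graph_dist E v (x i) + graph_dist E (x i) u"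
proof -
  have x: "x i \<in> V" using corner_in i by simp
  have V': "c i u \<in> V'" "c 0 v \<in> V'" "c i (x i) \<in> V'" using assms x by (auto intro: glue_verts_I)
  show "dist' (c i u) (c 0 v) \<le> graph_dist E u (x i) + graph_dist E (x i) v"
    using glue.dist_triangle[OF V'(1,3,2)] dist_same_copy[OF i(2) \<open>u \<in> V\<close> x]
      dist_same_copy[OF le0 x \<open>v \<in> V\<close>] by (simp add: copy_vert_glued[OF i(1)])
  show "dist' (c 0 v) (c i u) \<le> graph_dist E v (x i) + graph_dist E (x i) u"
    using glue.dist_triangle[OF V'(2,3,1)] dist_same_copy[OF i(2) x \<open>u \<in> V\<close>]
      dist_same_copy[OF le0 \<open>v \<in> V\<close> x] by (simp add: copy_vert_glued[OF i(1)])
qed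

lemma dist_across:
  assumes i: "1 \<le> i" "i \<le> N" and j: "1 \<le> j" "j \<le> N" "i \<noteq> j" and "u \<in> V" "v \<in> V"
  shows "dist' (c i u) (c j v) \<le> graph_dist E u (x i) + D + graph_dist E (x j) v"
proof -
  have x: "x i \<in> V" "x j \<in> V" using corner_in i j by auto
  have V': "c i u \<in> V'" "c j v \<in> V'" "c j (x j) \<in> V'" using assms x by (auto intro: glue_verts_I)
  show ?thesis
    using glue.dist_triangle[OF V'(1,3,2)] dist_to_centre(1)[OF i \<open>u \<in> V\<close> x(2)]
      dist_same_copy[OF j(2) x(2) \<open>v \<in> V\<close>] corner_dist[OF i j]
    by (simp add: copy_vert_glued[OF j(1)])
qed

lemma far_or_close:
  assumes "a \<in> V'" "b \<in> V'"
  obtains "dist' a b \<le> 2 * D"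
  | i j u v where "1 \<le> i" "i \<le> N" "1 \<le> j" "j \<le> N" "i \<noteq> j" "u \<in> V" "v \<in> V" "a = c i u" "b = c j v"
proof -
  obtain i u j v where *: "i \<le> N" "u \<in> V" "a = c i u" "j \<le> N" "v \<in> V" "b = c j v"
    using assms by (metis glue_verts_cases)
  consider "i = j" | "i = 0" "1 \<le> j" | "1 \<le> i" "j = 0" | "1 \<le> i" "1 \<le> j" "i \<noteq> j" by linarith
  then show thesis
  proof cases
    case 1
    then show ?thesis
      using that(1) * dist_same_copy[of i u v] dist_le_diam[of u v] by simp
  next
    case 2
    then show ?thesis
      using that(1) * dist_to_centre(2)[of j v u] dist_le_diam[of u "x j"] dist_le_diam[of "x j" v] corner_in[of j]
      by simp
  next
    case 3
    then show ?thesis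
      using that(1) * dist_to_centre(1)[of i u v] dist_le_diam[of u "x i"] dist_le_diam[of "x i" v] corner_in[of i]
      by simp
  next
    case 4
    then show ?thesis using that(2)[of i j u v] * by simp
  qed
qed

lemma dist_glue_le: assumes "a \<in> V'" "b \<in> V'" shows "dist' a b \<le> 3 * D"
  using assms
proof (cases rule: far_or_close)
  case (2 i j u v)
  then show ?thesis
    using dist_across[of i j u v] dist_le_diam[of u "x i"] dist_le_diam[of "x j" v] corner_in[of i] corner_in[of j]
    by simp
qed simp

text \<open>Every path between two outer copies crosses the central one. The lower bound comes from signed
  distances: minus the distance to \<open>x 1\<close> in copy \<open>1\<close>, the distance to \<open>x 1\<close> in the centre, and
  \<open>D\<close> plus the distance to \<open>x 2\<close> in copy \<open>2\<close>.\<close>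
lemma diam_glue: "graph_diam V' E' = 3 * D"
proof (rule glue.diam_eqI)
  \<comment> \<open>On the copies other than \<open>0, 1, 2\<close> the function is constant, with the value \<open>D\<close> of all corners but \<open>x 1\<close>.\<close>
  define F where "F i v = (if i = 1 then - int (graph_dist E (x 1) v)
     else if i = 0 then int (graph_dist E (x 1) v)
     else if i = 2 then int D + int (graph_dist E (x 2) v) else int D)" for i :: nat and v
  have x: "x 1 \<in> V" "x 2 \<in> V" using corner_in N_ge_2 by auto
  have F: "glued F (c i v) = F i v" if "i \<le> N" for i v
    using that corner_dist[of 1 i] by (intro glued_copy) (auto simp: F_def dist_self)
  have "glued F b \<le> glued F a + 1" if ab: "(a, b) \<in> E'" for a b
  proof -
    obtain i u v where *: "i \<le> N" "(u, v) \<in> E" "a = c i u" "b = c i v"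
      using ab by (rule glue_edges_cases)
    moreover have "(v, u) \<in> E" using * sym_edges by (auto dest: symD)
    ultimately show ?thesis
      using dist_step[OF x(1), of u v] dist_step[OF x(1), of v u] dist_step[OF x(2), of u v] F[of i]
      by (auto simp: F_def)
  qed
  moreover show V': "c 1 (x 2) \<in> V'" "c 2 (x 1) \<in> V'" using x N_ge_2 by (auto intro: glue_verts_I)
  ultimately have "glued F (c 2 (x 1)) - glued F (c 1 (x 2)) \<le> int (dist' (c 1 (x 2)) (c 2 (x 1)))"
    by (rule glue.dist_ge_lipschitz)
  then show "3 * D \<le> dist' (c 1 (x 2)) (c 2 (x 1))"
    using F[of 2] F[of 1] N_ge_2 corner_dist[of 1 2] corner_dist[of 2 1] by (simp add: F_def)
qed (rule dist_glue_le)

text \<open>Vertices at distance \<open>3 D\<close> lie in different outer copies, and equality holds in each of the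
  three legs of the path through the centre.\<close>
lemma antipodal_glue:
  assumes "a \<in> V'" "b \<in> V'" "dist' a b = graph_diam V' E'" "D > 0"
  obtains i j u v where "1 \<le> i" "i \<le> N" "1 \<le> j" "j \<le> N" "i \<noteq> j" "u \<in> V" "v \<in> V" "a = c i u" "b = c j v"
    "graph_dist E u (x i) = D" "graph_dist E (x j) v = D"
  using assms(1,2)
proof (cases rule: far_or_close)
  case 1
  then show ?thesis using assms(3,4) diam_glue by simp
next
  case (2 i j u v)
  moreover have "graph_dist E u (x i) \<le> D" "graph_dist E (x j) v \<le> D"
    using 2 corner_in dist_le_diam by auto
  ultimately have "graph_dist E u (x i) = D" "graph_dist E (x j) v = D"
    using dist_across[of i j u v] assms(3) diam_glue by auto
  then show ?thesis using that 2 by blast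
qed

lemma corner_extremal: assumes "1 \<le> i" "i \<le> N" shows "extremal V E (x i)"
proof -
  obtain j where "1 \<le> j" "j \<le> N" "j \<noteq> i"
    using N_ge_2 by (cases "i = 1") (auto intro: that[of 1] that[of 2])
  then show ?thesis using corner_in corner_dist assms unfolding extremal_def by metis
qed

end

section \<open>Viscek graphs\<close>

lemma sum_star_edges: "(\<Sum>(u, v)\<in>star_edges N. g u v) = (\<Sum>i=1..N. g [0] [i] + g [i] [0])"
proof -
  have 1: "{([0], [i]) | i. 1 \<le> i \<and> i \<le> N} = (\<lambda>i. ([0], [i])) ` {1..N}" by auto
  have 2: "{([i], [0]) | i. 1 \<le> i \<and> i \<le> N} = (\<lambda>i. ([i], [0])) ` {1..N}" by auto
  show ?thesis
    unfolding star_edges_def 1 2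
    by (subst sum.union_disjoint) (auto simp: sum.reindex inj_on_def sum.distrib)
qed

lemma finite_graph_star: assumes "N \<ge> 1" shows "finite_graph (star_verts N) (star_edges N)"
proof
  have sv: "star_verts N = (\<lambda>i. [i]) ` {..N}" by (auto simp: star_verts_def)
  show "finite (star_verts N)" "star_verts N \<noteq> {}" by (auto simp: sv)
  show "star_edges N \<subseteq> star_verts N \<times> star_verts N" by (auto simp: star_edges_def star_verts_def)
  show "sym (star_edges N)" by (auto simp: star_edges_def intro!: symI)
  show "irrefl (star_edges N)" by (auto simp: star_edges_def irrefl_def)
  have e: "([0], [i]) \<in> star_edges N" "([i], [0]) \<in> star_edges N" if "1 \<le> i" "i \<le> N" for i
    using that by (auto simp: star_edges_def)
  show "\<exists>y. (v, y) \<in> star_edges N" if v: "v \<in> star_verts N" for v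
  proof -
    obtain i where i: "v = [i]" "i \<le> N" using v by (auto simp: sv)
    then show ?thesis using e(1)[of 1] e(2)[of i] assms by (cases "i = 0") auto
  qed
  have r: "([0], [i]) \<in> (star_edges N)\<^sup>*" "([i], [0]) \<in> (star_edges N)\<^sup>*" if "i \<le> N" for i
    using e[of i] that by (cases "i = 0"; auto)+
  show "(u, v) \<in> (star_edges N)\<^sup>*" if "u \<in> star_verts N" "v \<in> star_verts N" for u v
    using that r unfolding sv by (auto intro: rtrancl_trans)
qed

lemma star_dist:
  assumes "i \<le> N" "j \<le> N" "N \<ge> 1"
  shows "graph_dist (star_edges N) [i] [j] = (if i = j then 0 else if i = 0 \<or> j = 0 then 1 else 2)"
proof -
  interpret finite_graph "star_verts N" "star_edges N" by (rule finite_graph_star[OF assms(3)])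
  have v: "[k] \<in> star_verts N" if "k \<le> N" for k using that by (auto simp: star_verts_def)
  have e: "([0], [k]) \<in> star_edges N" "([k], [0]) \<in> star_edges N" if "k \<noteq> 0" "k \<le> N" for k
    using that by (auto simp: star_edges_def)
  have up: "graph_dist (star_edges N) [i] [j] \<le> (if i = j then 0 else if i = 0 \<or> j = 0 then 1 else 2)"
    using dist_triangle[OF v[OF assms(1)] v[of 0] v[OF assms(2)]] e[of i] e[of j] assms
      dist_edge[of "[i]" "[0]"] dist_edge[of "[0]" "[j]"]
    by (cases "i = 0"; cases "j = 0") (auto simp: dist_self)
  have "int (if i = j then 0 else if i = 0 \<or> j = 0 then 1 else 2) \<le> int (graph_dist (star_edges N) [i] [j])"
  proof -
    define g where "g w = (if w = [i] then 0 else if w = [j] then (if i = 0 \<or> j = 0 then 1 else 2) else (1::int))" for w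
    have "g v \<le> g u + 1" if "(u, v) \<in> star_edges N" for u v
      using that by (auto simp: g_def star_edges_def)
    then show ?thesis
      using dist_ge_lipschitz[of g "[i]" "[j]"] v assms by (auto simp: g_def split: if_splits)
  qed
  then show ?thesis using up by (auto split: if_splits)
qed

lemma star_diam: assumes "N \<ge> 2" shows "graph_diam (star_verts N) (star_edges N) = 2"
proof (rule finite_graph.diam_eqI)
  show "finite_graph (star_verts N) (star_edges N)" using assms by (intro finite_graph_star) simp
  show "[1] \<in> star_verts N" "[2] \<in> star_verts N" using assms by (auto simp: star_verts_def)
qed (use assms in \<open>auto simp: star_dist star_verts_def\<close>)

lemma viscek_graph:
  assumes "N \<ge> 2" "viscek N n V E"
  shows "finite_graph V E \<and> graph_diam V E = 2 * 3 ^ n \<and> card E = 2 * N * (N + 1) ^ n"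
  using assms(2)
proof (induction rule: viscek.induct)
  case viscek_0
  have "card (star_edges N) = 2 * N"
    using sum_star_edges[of "\<lambda>u v. 1 :: nat" N] by (simp add: case_prod_unfold)
  then show ?case using finite_graph_star[of N] star_diam[OF assms(1)] assms(1) by simp
next
  case (viscek_Suc n V E x)
  then interpret finite_graph V E by simp
  interpret gluing V E N x by unfold_locales (use viscek_Suc assms(1) in auto)
  show ?case using finite_graph_glue diam_glue card_glue_edges viscek_Suc.IH by (simp add: algebra_simps)
qed

text \<open>The induction principle behind all that follows: the gluing step is available as a locale
  instance in which the diameter is positive.\<close>
lemma viscek_induct [consumes 2, case_names star glue]:
  assumes "N \<ge> 2" "viscek N n V E"
    and "P 0 (star_verts N) (star_edges N)"
    and "\<And>n V E x. viscek N n V E \<Longrightarrow> gluing V E N x \<Longrightarrow> graph_diam V E > 0 \<Longrightarrow> P n V E \<Longrightarrow>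
       P (Suc n) (glue_verts N x V) (glue_edges N x E)"
  shows "P n V E"
  using assms(2)
proof (induction rule: viscek.induct)
  case (viscek_Suc n V E x)
  then interpret finite_graph V E using viscek_graph[OF assms(1)] by simp
  have "gluing V E N x" by unfold_locales (use viscek_Suc assms(1) in auto)
  then show ?case using viscek_Suc viscek_graph[OF assms(1) viscek_Suc.hyps(1)] by (intro assms(4)) auto
qed (rule assms(3))

lemma viscek_card_edges:
  assumes "N \<ge> 2" "viscek N n V E" shows "real (card E) = 2 * real N * (real N + 1) ^ n"
  using viscek_graph[OF assms] by (simp add: add.commute)

section \<open>Oscillation, two-point functions and a Faber--Krahn inequality\<close>

lemma sum_subset_le:
  fixes e :: "nat \<Rightarrow> real"
  assumes "finite I" "A \<subseteq> I" "\<And>i. i \<in> I \<Longrightarrow> e i \<ge> 0"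
  shows "sum e A \<le> sum e I"
  using assms by (intro sum_mono2) auto

lemma square_sum3_le: "(a + b + c)\<^sup>2 \<le> 3 * (a\<^sup>2 + b\<^sup>2 + c\<^sup>2)" for a b c :: real
proof -
  have "3 * (a\<^sup>2 + b\<^sup>2 + c\<^sup>2) - (a + b + c)\<^sup>2 = (a - b)\<^sup>2 + (b - c)\<^sup>2 + (a - c)\<^sup>2"
    by (simp add: power2_eq_square algebra_simps)
  then show ?thesis by (metis diff_ge_0_iff_ge add_nonneg_nonneg zero_le_power2)
qed

text \<open>Energies are resistances here: a path crosses at most three copies, and the squared oscillation
  over three copies is at most three times the sum of the squared oscillations over each of
  them.\<close>
lemma viscek_oscillation:
  assumes "N \<ge> 2" "viscek N n V E"
  shows "\<forall>f. \<forall>u\<in>V. \<forall>v\<in>V. (f u - f v)\<^sup>2 \<le> 3 ^ n * edge_energy E f"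
  using assms
proof (induction rule: viscek_induct)
  case star
  show ?case
  proof (intro allI ballI)
    fix f :: "nat list \<Rightarrow> real" and u v
    assume "u \<in> star_verts N" "v \<in> star_verts N"
    then obtain i j where ij: "u = [i]" "i \<le> N" "v = [j]" "j \<le> N" by (auto simp: star_verts_def)
    define e where "e k = (if k = 0 then 0 else 2 * (f [0] - f [k])\<^sup>2)" for k
    have e_nonneg: "e k \<ge> 0" for k by (simp add: e_def)
    have en: "edge_energy (star_edges N) f = (\<Sum>k\<le>N. e k)"
    proof -
      have "edge_energy (star_edges N) f = (\<Sum>k=1..N. e k)"
        unfolding edge_energy_def sum_star_edges by (rule sum.cong) (auto simp: e_def power2_commute)
      also have "\<dots> = (\<Sum>k\<le>N. e k)" by (rule sum.mono_neutral_left) (auto simp: e_def)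
      finally show ?thesis .
    qed
    have e_half: "(f [0] - f [k])\<^sup>2 = e k / 2" for k by (simp add: e_def)
    show "(f u - f v)\<^sup>2 \<le> 3 ^ 0 * edge_energy (star_edges N) f"
    proof (cases "i = j")
      case True
      then show ?thesis using ij by (simp add: edge_energy_nonneg)
    next
      case False
      have "f u - f v = (f [0] - f [j]) - (f [0] - f [i])" using ij by simp
      also have "\<dots>\<^sup>2 \<le> 2 * ((f [0] - f [j])\<^sup>2 + (f [0] - f [i])\<^sup>2)"
        using zero_le_power2[of "(f [0] - f [j]) + (f [0] - f [i])"]
        by (simp add: power2_eq_square algebra_simps)
      also have "\<dots> = sum e {i, j}" using False by (simp add: e_half)
      also have "\<dots> \<le> (\<Sum>k\<le>N. e k)" using ij e_nonneg by (intro sum_subset_le) auto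
      finally show ?thesis by (simp add: en)
    qed
  qed
next
  case (glue n V E x)
  then interpret gluing V E N x by simp
  show ?case
  proof (intro allI ballI)
    fix f :: "nat list \<Rightarrow> real" and a b
    assume a: "a \<in> V'" and b: "b \<in> V'"
    define A where "A i v = f (c i v)" for i v
    define e where "e i = edge_energy E (A i)" for i
    have e_nonneg: "e i \<ge> 0" for i by (simp add: e_def edge_energy_nonneg)
    have en: "edge_energy E' f = (\<Sum>i\<le>N. e i)" by (simp add: energy_glue e_def A_def[abs_def])
    have IH: "(A i u - A i v)\<^sup>2 \<le> 3 ^ n * e i" if "u \<in> V" "v \<in> V" for i u v
      using glue.IH that by (simp add: e_def)
    have gate: "A i (x i) = A 0 (x i)" if "1 \<le> i" for i
      using copy_vert_glued[OF that] by (simp add: A_def)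
    have three: "(p + q + r)\<^sup>2 \<le> 3 ^ Suc n * edge_energy E' f"
      if "p\<^sup>2 \<le> 3 ^ n * e i" "q\<^sup>2 \<le> 3 ^ n * e j" "r\<^sup>2 \<le> 3 ^ n * e k"
        "i \<le> N" "j \<le> N" "k \<le> N" "i \<noteq> j" "i \<noteq> k" "j \<noteq> k" for p q r i j k
    proof -
      have "(p + q + r)\<^sup>2 \<le> 3 * (p\<^sup>2 + q\<^sup>2 + r\<^sup>2)" by (rule square_sum3_le)
      also have "\<dots> \<le> 3 ^ Suc n * (sum e {i, j, k})" using that by (simp add: algebra_simps)
      also have "\<dots> \<le> 3 ^ Suc n * (\<Sum>i\<le>N. e i)"
        using that e_nonneg by (intro mult_left_mono sum_subset_le) auto
      finally show ?thesis by (simp add: en)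
    qed
    obtain i u j v where *: "i \<le> N" "u \<in> V" "a = c i u" "j \<le> N" "v \<in> V" "b = c j v"
      using a b by (metis glue_verts_cases)
    \<comment> \<open>Only two copies are crossed; the third one contributes zero and can be any other.\<close>
    have centre: "(A i u - A 0 v)\<^sup>2 \<le> 3 ^ Suc n * edge_energy E' f"
      if i: "1 \<le> i" "i \<le> N" and uv: "u \<in> V" "v \<in> V" for i u v
    proof -
      obtain k where k: "k \<noteq> i" "k \<noteq> 0" "k \<le> N"
        using N_ge_2 by (cases "i = 1") (auto intro: that[of 1] that[of 2])
      have "((A i u - A i (x i)) + (A 0 (x i) - A 0 v) + 0)\<^sup>2 \<le> 3 ^ Suc n * edge_energy E' f"
        using IH[OF uv(1) corner_in[OF i], of i] IH[OF corner_in[OF i] uv(2), of 0] i k e_nonneg[of k]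
        by (intro three[of _ i _ 0 _ k]) auto
      then show ?thesis using gate[OF i(1)] by simp
    qed
    consider "i = j" | "i = 0" "1 \<le> j" | "1 \<le> i" "j = 0" | "1 \<le> i" "1 \<le> j" "i \<noteq> j" by linarith
    then have "(A i u - A j v)\<^sup>2 \<le> 3 ^ Suc n * edge_energy E' f"
    proof cases
      case 1
      have "(A i u - A i v)\<^sup>2 \<le> 3 ^ n * e i" using IH * by simp
      also have "\<dots> \<le> 3 ^ Suc n * sum e {i}" using e_nonneg[of i] by simp
      also have "\<dots> \<le> 3 ^ Suc n * (\<Sum>i\<le>N. e i)"
        using * e_nonneg by (intro mult_left_mono sum_subset_le) auto
      finally show ?thesis using 1 by (simp add: en)
    next
      case 2
      then show ?thesis using centre[of j v u] * by (simp add: power2_commute)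
    next
      case 3
      then show ?thesis using centre[of i u v] * by simp
    next
      case 4
      have x: "x i \<in> V" "x j \<in> V" using corner_in 4 * by auto
      have "((A i u - A i (x i)) + (A 0 (x i) - A 0 (x j)) + (A j (x j) - A j v))\<^sup>2 \<le> 3 ^ Suc n * edge_energy E' f"
        by (rule three[of _ i _ 0 _ j]) (use IH x * 4 in auto)
      then show ?thesis using gate[of i] gate[of j] 4 by simp
    qed
    then show "(f a - f b)\<^sup>2 \<le> 3 ^ Suc n * edge_energy E' f" using * by (simp add: A_def)
  qed
qed

text \<open>The potential for the unit voltage between two antipodal vertices. In each of the three
  copies on the way it rises by one third, which costs one ninth of the energy of level \<open>n\<close>; on every
  other copy it keeps its value at the gluing point.\<close>
lemma viscek_two_point:
  assumes "N \<ge> 2" "viscek N n V E"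
  shows "\<forall>a\<in>V. \<forall>b\<in>V. graph_dist E a b = graph_diam V E \<longrightarrow>
    (\<exists>s. (\<forall>v\<in>V. 0 \<le> s v \<and> s v \<le> 1) \<and> s a = 0 \<and> s b = 1 \<and> edge_energy E s \<le> 1 / 3 ^ n)"
  using assms
proof (induction rule: viscek_induct)
  case star
  show ?case
  proof (intro ballI impI)
    fix a b assume ab: "a \<in> star_verts N" "b \<in> star_verts N"
      and d: "graph_dist (star_edges N) a b = graph_diam (star_verts N) (star_edges N)"
    then obtain i j where ij: "a = [i]" "i \<le> N" "b = [j]" "j \<le> N" by (auto simp: star_verts_def)
    then have ne: "i \<noteq> j" "i \<noteq> 0" "j \<noteq> 0"
      using d assms(1) star_dist[of i N j] star_diam[of N] by (auto split: if_splits)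
    define s where "s w = (if w = a then 0 else if w = b then 1 else 1 / 2 :: real)" for w
    have "edge_energy (star_edges N) s = (\<Sum>k=1..N. 2 * (s [k] - 1 / 2)\<^sup>2)"
      unfolding edge_energy_def sum_star_edges
      by (rule sum.cong) (use ij ne in \<open>auto simp: s_def power2_commute\<close>)
    also have "\<dots> = (\<Sum>k\<in>{i, j}. 2 * (s [k] - 1 / 2)\<^sup>2)"
      by (rule sum.mono_neutral_right) (use ij ne in \<open>auto simp: s_def\<close>)
    also have "\<dots> = 1" using ij ne by (simp add: s_def power2_eq_square)
    finally show "\<exists>s. (\<forall>v\<in>star_verts N. 0 \<le> s v \<and> s v \<le> 1) \<and> s a = 0 \<and> s b = 1
        \<and> edge_energy (star_edges N) s \<le> 1 / 3 ^ 0"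
      using ij ne by (intro exI[of _ s]) (auto simp: s_def)
  qed
next
  case (glue n V E x)
  then interpret gluing V E N x by simp
  show ?case
  proof (intro ballI impI)
    fix a b assume "a \<in> V'" "b \<in> V'" "dist' a b = graph_diam V' E'"
    then obtain i j u v where ij: "1 \<le> i" "i \<le> N" "1 \<le> j" "j \<le> N" "i \<noteq> j" and uv: "u \<in> V" "v \<in> V"
      and ab: "a = c i u" "b = c j v" and d: "graph_dist E u (x i) = D" "graph_dist E (x j) v = D"
      using glue.hyps(3) by (rule antipodal_glue)
    have x: "x i \<in> V" "x j \<in> V" "graph_dist E (x i) (x j) = D" using corner_in corner_dist ij by auto
    obtain s1 where s1: "\<forall>v\<in>V. 0 \<le> s1 v \<and> s1 v \<le> 1" "s1 u = 0" "s1 (x i) = 1" "edge_energy E s1 \<le> 1 / 3 ^ n"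
      using glue.IH uv x d by blast
    obtain s2 where s2: "\<forall>v\<in>V. 0 \<le> s2 v \<and> s2 v \<le> 1" "s2 (x i) = 0" "s2 (x j) = 1" "edge_energy E s2 \<le> 1 / 3 ^ n"
      using glue.IH x by blast
    obtain s3 where s3: "\<forall>v\<in>V. 0 \<le> s3 v \<and> s3 v \<le> 1" "s3 (x j) = 0" "s3 v = 1" "edge_energy E s3 \<le> 1 / 3 ^ n"
      using glue.IH uv x d by blast
    define F where "F k w = (if k = i then (0 + s1 w) / 3 else if k = j then (2 + s3 w) / 3
      else if k = 0 then (1 + s2 w) / 3 else (1 + s2 (x k)) / 3)" for k w
    have F: "glued F (c k w) = F k w" for k w
      by (rule glued_copy) (use s1 s2 s3 ij in \<open>auto simp: F_def\<close>)
    have "edge_energy E' (glued F) = (\<Sum>k\<le>N. edge_energy E (F k))"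
      by (simp add: energy_glue F)
    also have "\<dots> = (\<Sum>k\<in>{i, j, 0}. edge_energy E (F k))"
      by (rule sum.mono_neutral_right) (use ij in \<open>auto simp: F_def[abs_def] energy_const\<close>)
    also have "\<dots> = (edge_energy E s1 + edge_energy E s3 + edge_energy E s2) / 9"
    proof -
      have "F i = (\<lambda>w. (0 + s1 w) / 3)" "F j = (\<lambda>w. (2 + s3 w) / 3)" "F 0 = (\<lambda>w. (1 + s2 w) / 3)"
        using ij by (auto simp: F_def[abs_def])
      then have "edge_energy E (F i) = edge_energy E s1 / 3\<^sup>2" "edge_energy E (F j) = edge_energy E s3 / 3\<^sup>2"
        "edge_energy E (F 0) = edge_energy E s2 / 3\<^sup>2" by (simp_all only: energy_affine)
      then show ?thesis using ij by simp
    qed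
    also have "\<dots> \<le> 1 / 3 ^ Suc n" using s1(4) s2(4) s3(4) by simp
    finally have "edge_energy E' (glued F) \<le> 1 / 3 ^ Suc n" .
    moreover have "0 \<le> F k w \<and> F k w \<le> 1" if "k \<le> N" "w \<in> V" for k w
    proof -
      have "0 \<le> s2 (x k) \<and> s2 (x k) \<le> 1" if "k \<noteq> 0" using s2(1) corner_in[of k] that \<open>k \<le> N\<close> by simp
      then show ?thesis using s1(1) s2(1) s3(1) \<open>w \<in> V\<close> by (auto simp: F_def)
    qed
    then have "\<forall>w\<in>V'. 0 \<le> glued F w \<and> glued F w \<le> 1" using F by (metis glue_verts_cases)
    moreover have "glued F a = 0" "glued F b = 1" using ab F s1 s3 ij by (auto simp: F_def)
    ultimately show "\<exists>s. (\<forall>v\<in>V'. 0 \<le> s v \<and> s v \<le> 1) \<and> s a = 0 \<and> s b = 1 \<and> edge_energy E' s \<le> 1 / 3 ^ Suc n"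
      by blast
  qed
qed

text \<open>A function whose support has less than full mass has a zero, and the oscillation bound is applied
  between that zero and every other vertex.\<close>
lemma viscek_faber_krahn_base:
  assumes N: "N \<ge> 2" and V: "viscek N n V E"
    and small: "(\<Sum>(u, v)\<in>E. if f u = 0 then 0 else 1) < real (card E)"
  shows "(\<Sum>(u, v)\<in>E. (f u)\<^sup>2) \<le> real (card E) * 3 ^ n * edge_energy E f"
proof -
  interpret finite_graph V E using viscek_graph[OF N V] by simp
  have "\<exists>z\<in>V. f z = 0"
  proof (rule ccontr)
    assume "\<not> ?thesis"
    then have "(\<Sum>(u, v)\<in>E. if f u = 0 then 0 else 1) = (\<Sum>(u, v)\<in>E. 1 :: real)"
      by (intro sum.cong) (auto dest: edge_verts)
    then show False using small by (simp add: case_prod_unfold)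
  qed
  then obtain z where z: "z \<in> V" "f z = 0" by blast
  have "(f u)\<^sup>2 \<le> 3 ^ n * edge_energy E f" if "u \<in> V" for u
    using viscek_oscillation[OF N V, rule_format, OF that z(1), of f] z(2) by simp
  then have "(\<Sum>(u, v)\<in>E. (f u)\<^sup>2) \<le> (\<Sum>(u, v)\<in>E. 3 ^ n * edge_energy E f)"
    by (intro sum_mono) (auto dest: edge_verts)
  then show ?thesis by (simp add: case_prod_unfold mult.assoc)
qed

text \<open>Induction on \<open>n\<close>: the support hypothesis passes to each copy, and both sides add up over
  the copies. The induction starts at \<open>n = k\<close>, where the support is smaller than the whole graph.\<close>
lemma viscek_faber_krahn:
  assumes N: "N \<ge> 2" and V: "viscek N n V E" and "k \<le> n"
    and "(\<Sum>(u, v)\<in>E. if f u = 0 then 0 else 1) < 2 * real N * (real N + 1) ^ k"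
  shows "(\<Sum>(u, v)\<in>E. (f u)\<^sup>2) \<le> 2 * real N * (real N + 1) ^ k * 3 ^ k * edge_energy E f"
proof -
  have card: "real (card E) = 2 * real N * (real N + 1) ^ n" if "viscek N n V E" for n V E
    using viscek_graph[OF N that] by (simp add: add.commute)
  have "\<forall>f. k \<le> n \<longrightarrow> (\<Sum>(u, v)\<in>E. if f u = 0 then 0 else 1) < 2 * real N * (real N + 1) ^ k \<longrightarrow>
     (\<Sum>(u, v)\<in>E. (f u)\<^sup>2) \<le> 2 * real N * (real N + 1) ^ k * 3 ^ k * edge_energy E f"
    using N V
  proof (induction rule: viscek_induct)
    case star
    show ?case
      using viscek_faber_krahn_base[OF N viscek_0] card[OF viscek_0] by simp
  next
    case (glue n V E x)
    then interpret gluing V E N x by simp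
    have step: "viscek N (Suc n) V' E'"
      using glue.hyps corner_in corner_dist by (intro viscek_Suc) auto
    show ?case
    proof (intro allI impI)
      fix f :: "nat list \<Rightarrow> real"
      assume k: "k \<le> Suc n"
        and small: "(\<Sum>(u, v)\<in>E'. if f u = 0 then 0 else 1) < 2 * real N * (real N + 1) ^ k"
      show "(\<Sum>(u, v)\<in>E'. (f u)\<^sup>2) \<le> 2 * real N * (real N + 1) ^ k * 3 ^ k * edge_energy E' f"
      proof (cases "k = Suc n")
        case True
        then show ?thesis using viscek_faber_krahn_base[OF N step, of f] card[OF step] small by simp
      next
        case False
        define m :: "nat \<Rightarrow> real" where "m i = (\<Sum>(u, v)\<in>E. if f (c i u) = 0 then 0 else 1)" for i
        have copy: "(\<Sum>(u, v)\<in>E. (f (c i u))\<^sup>2)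
            \<le> 2 * real N * (real N + 1) ^ k * 3 ^ k * edge_energy E (\<lambda>v. f (c i v))" if "i \<le> N" for i
        proof -
          have "m i \<le> (\<Sum>i\<le>N. m i)"
            using that by (intro member_le_sum) (auto simp: m_def intro!: sum_nonneg)
          also have "\<dots> = (\<Sum>(u, v)\<in>E'. if f u = 0 then 0 else 1)"
            unfolding m_def by (rule sum_glue[symmetric])
          finally show ?thesis using glue.IH small k False by (simp add: m_def)
        qed
        show ?thesis
          unfolding sum_glue energy_glue sum_distrib_left[of _ _ "{..N}"] by (rule sum_mono) (use copy in auto)
      qed
    qed
  qed
  then show ?thesis using assms by blast
qed

section \<open>Test functions\<close>

context gluing
begin

lemma extremal_in_outer_copy:
  assumes "extremal V' E' y" "D > 0"
  obtains i u where "1 \<le> i" "i \<le> N" "u \<in> V" "y = c i u" "graph_dist E u (x i) = D"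
proof -
  obtain w where w: "y \<in> V'" "w \<in> V'" "dist' y w = graph_diam V' E'"
    using assms(1) by (auto simp: extremal_def)
  show thesis by (rule antipodal_glue[OF w assms(2)]) (rule that)
qed

text \<open>The two-point function is placed in the single outer copy that contains \<open>y\<close>; everything else
  is kept at height one.\<close>
lemma extremal_cutoff:
  assumes V: "viscek N m V E" and y: "extremal V' E' y" and "D > 0"
  shows "\<exists>t. (\<forall>w\<in>V'. 0 \<le> t w \<and> t w \<le> 1) \<and> t y = 0 \<and> (\<forall>v\<in>V. t (c 0 v) = 1) \<and> edge_energy E' t \<le> 1 / 3 ^ m"
proof -
  obtain i u where i: "1 \<le> i" "i \<le> N" "u \<in> V" "y = c i u" "graph_dist E u (x i) = D"
    using y \<open>D > 0\<close> by (rule extremal_in_outer_copy)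
  obtain s where s: "\<forall>v\<in>V. 0 \<le> s v \<and> s v \<le> 1" "s u = 0" "s (x i) = 1" "edge_energy E s \<le> 1 / 3 ^ m"
    using viscek_two_point[OF N_ge_2 V] i corner_in by blast
  define F where "F k = (if k = i then s else (\<lambda>_. 1))" for k
  have F: "glued F (c k w) = F k w" for k w
    by (rule glued_copy) (use s i in \<open>auto simp: F_def\<close>)
  have "edge_energy E' (glued F) = (\<Sum>k\<le>N. edge_energy E (F k))" by (simp add: energy_glue F)
  also have "\<dots> = (\<Sum>k\<in>{i}. edge_energy E (F k))"
    by (rule sum.mono_neutral_right) (use i in \<open>auto simp: F_def energy_const\<close>)
  finally have "edge_energy E' (glued F) \<le> 1 / 3 ^ m" using s by (simp add: F_def)
  moreover have "\<forall>w\<in>V'. 0 \<le> glued F w \<and> glued F w \<le> 1"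
    using s(1) by (auto elim!: glue_verts_cases simp: F F_def)
  moreover have "glued F y = 0" "\<forall>v\<in>V. glued F (c 0 v) = 1" using i s by (auto simp: F F_def)
  ultimately show ?thesis by blast
qed

text \<open>Extremal vertices of the glued graph lie in outer copies, where the extension vanishes, so the
  extension can be repeated at all higher levels.\<close>
lemma extend_by_zero:
  assumes f: "\<And>v. v \<in> V \<Longrightarrow> 0 \<le> f v" "\<And>i. 1 \<le> i \<Longrightarrow> i \<le> N \<Longrightarrow> f (x i) = 0" and "D > 0"
  obtains g where "\<And>w. w \<in> V' \<Longrightarrow> 0 \<le> g w" "\<And>w. extremal V' E' w \<Longrightarrow> g w = 0"
    "edge_energy E' g = edge_energy E f"
    "\<And>h :: real \<Rightarrow> real. h 0 = 0 \<Longrightarrow> (\<Sum>(u, v)\<in>E'. h (g u)) = (\<Sum>(u, v)\<in>E. h (f u))"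
proof -
  define F where "F k = (if k = 0 then f else (\<lambda>_. 0 :: real))" for k :: nat
  have F: "glued F (c k w) = F k w" if "k \<le> N" for k w
    by (rule glued_copy) (use f(2)[of k] that in \<open>auto simp: F_def\<close>)
  show thesis
  proof (rule that[of "glued F"])
    show "0 \<le> glued F w" if "w \<in> V'" for w
      using that f(1) by (auto elim!: glue_verts_cases simp: F F_def)
    show "glued F w = 0" if "extremal V' E' w" for w
      using that \<open>D > 0\<close> by (rule extremal_in_outer_copy) (simp add: F F_def)
    have "edge_energy E' (glued F) = (\<Sum>k\<le>N. edge_energy E (F k))" by (simp add: energy_glue F)
    also have "\<dots> = (\<Sum>k\<in>{0}. edge_energy E (F k))"
      by (rule sum.mono_neutral_right) (auto simp: F_def energy_const)
    finally show "edge_energy E' (glued F) = edge_energy E f" by (simp add: F_def)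
    show "(\<Sum>(u, v)\<in>E'. h (glued F u)) = (\<Sum>(u, v)\<in>E. h (f u))" if h: "h 0 = 0" for h :: "real \<Rightarrow> real"
    proof -
      have "(\<Sum>(u, v)\<in>E'. h (glued F u)) = (\<Sum>k\<le>N. \<Sum>(u, v)\<in>E. h (F k u))"
        unfolding sum_glue by (simp add: F)
      also have "\<dots> = (\<Sum>k\<in>{0}. \<Sum>(u, v)\<in>E. h (F k u))"
        by (rule sum.mono_neutral_right) (auto simp: F_def h case_prod_unfold)
      finally show ?thesis by (simp add: F_def)
    qed
  qed
qed

end

text \<open>The minimum of the cutoffs belonging to the \<open>N\<close> prescribed extremal vertices. Each cutoff is
  one on the central copy, which is a graph of level \<open>m\<close>.\<close>
lemma viscek_plateau:
  assumes "N \<ge> 2" "viscek N n V E"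
  shows "\<forall>m x. n = Suc m \<longrightarrow> (\<forall>i\<in>{1..N}. extremal V E (x i)) \<longrightarrow>
    (\<exists>f. (\<forall>v\<in>V. 0 \<le> f v) \<and> (\<forall>i\<in>{1..N}. f (x i) = 0) \<and> edge_energy E f \<le> real N / 3 ^ m \<and>
      2 * real N * (real N + 1) ^ m \<le> (\<Sum>(u, v)\<in>E. (f u)\<^sup>2))"
  using assms
proof (induction rule: viscek_induct)
  case (glue n V E x)
  then interpret gluing V E N x by simp
  show ?case
  proof (intro allI impI)
    fix m y assume "Suc n = Suc m" and y: "\<forall>i\<in>{1..N}. extremal V' E' (y i)"
    have V: "viscek N m V E" using glue.hyps \<open>Suc n = Suc m\<close> by simp
    have "\<forall>i\<in>{1..N}. \<exists>t. (\<forall>w\<in>V'. 0 \<le> t w \<and> t w \<le> 1) \<and> t (y i) = 0 \<and>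
        (\<forall>v\<in>V. t (c 0 v) = 1) \<and> edge_energy E' t \<le> 1 / 3 ^ m"
      using y extremal_cutoff[OF V] glue.hyps(3) by blast
    then obtain t where t: "\<And>i. i \<in> {1..N} \<Longrightarrow> (\<forall>w\<in>V'. 0 \<le> t i w \<and> t i w \<le> 1) \<and> t i (y i) = 0 \<and>
        (\<forall>v\<in>V. t i (c 0 v) = 1) \<and> edge_energy E' (t i) \<le> 1 / 3 ^ m"
      by metis
    define f where "f w = (MIN i\<in>{1..N}. t i w)" for w
    have ne: "{1..N} \<noteq> {}" using N_ge_2 by simp
    have f_nonneg: "0 \<le> f w" if "w \<in> V'" for w
      unfolding f_def using ne t that by (intro Min.boundedI) auto
    have "f (y i) = 0" if i: "i \<in> {1..N}" for i
    proof -
      have "f (y i) \<le> t i (y i)" unfolding f_def using i by (intro Min_le) auto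
      moreover have "y i \<in> V'" using y i by (auto simp: extremal_def)
      ultimately show ?thesis using f_nonneg[of "y i"] t[OF i] by simp
    qed
    moreover have "edge_energy E' f \<le> real N / 3 ^ m"
    proof -
      have "edge_energy E' f \<le> (\<Sum>i=1..N. edge_energy E' (t i))"
        unfolding f_def using ne by (intro energy_min_le) auto
      also have "\<dots> \<le> (\<Sum>i=1..N. 1 / 3 ^ m)" using t by (intro sum_mono) auto
      finally show ?thesis by simp
    qed
    moreover have "2 * real N * (real N + 1) ^ m \<le> (\<Sum>(u, v)\<in>E'. (f u)\<^sup>2)"
    proof -
      have one: "f (c 0 v) = 1" if "v \<in> V" for v
      proof -
        have "(\<lambda>i. t i (c 0 v)) ` {1..N} = {1}" using t that ne by auto
        then show ?thesis by (simp add: f_def)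
      qed
      have "2 * real N * (real N + 1) ^ m = (\<Sum>(u, v)\<in>E. (f (c 0 u))\<^sup>2)"
      proof -
        have "(\<Sum>(u, v)\<in>E. (f (c 0 u))\<^sup>2) = (\<Sum>(u, v)\<in>E. 1)"
          by (rule sum.cong) (auto simp: one dest: edge_verts)
        then show ?thesis using viscek_card_edges[OF N_ge_2 V] by (simp add: case_prod_unfold)
      qed
      also have "\<dots> \<le> (\<Sum>k\<le>N. \<Sum>(u, v)\<in>E. (f (c k u))\<^sup>2)"
        by (rule member_le_sum) (auto intro!: sum_nonneg)
      also have "\<dots> = (\<Sum>(u, v)\<in>E'. (f u)\<^sup>2)" by (rule sum_glue[symmetric])
      finally show ?thesis .
    qed
    ultimately show "\<exists>f. (\<forall>v\<in>V'. 0 \<le> f v) \<and> (\<forall>i\<in>{1..N}. f (y i) = 0) \<and> edge_energy E' f \<le> real N / 3 ^ m \<and>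
      2 * real N * (real N + 1) ^ m \<le> (\<Sum>(u, v)\<in>E'. (f u)\<^sup>2)"
      using f_nonneg by blast
  qed
qed simp

text \<open>At level \<open>m + 2\<close> the plateau function sits in the central copy and vanishes at its gluing points;
  from there on it is extended by zero. The support stays inside a graph of level \<open>m + 1\<close>.\<close>
lemma viscek_bump:
  assumes "N \<ge> 2" "viscek N n V E"
  shows "\<forall>m. m + 2 \<le> n \<longrightarrow> (\<exists>f. (\<forall>v\<in>V. 0 \<le> f v) \<and> (\<forall>v. extremal V E v \<longrightarrow> f v = 0) \<and>
    edge_energy E f \<le> real N / 3 ^ m \<and> 2 * real N * (real N + 1) ^ m \<le> (\<Sum>(u, v)\<in>E. (f u)\<^sup>2) \<and>
    (\<Sum>(u, v)\<in>E. if f u = 0 then 0 else 1) \<le> 2 * real N * (real N + 1) ^ (m + 1))"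
  using assms
proof (induction rule: viscek_induct)
  case (glue n V E x)
  then interpret gluing V E N x by simp
  show ?case
  proof (intro allI impI)
    fix m assume m: "m + 2 \<le> Suc n"
    have "\<exists>f. (\<forall>v\<in>V. 0 \<le> f v) \<and> (\<forall>i\<in>{1..N}. f (x i) = 0) \<and>
      edge_energy E f \<le> real N / 3 ^ m \<and> 2 * real N * (real N + 1) ^ m \<le> (\<Sum>(u, v)\<in>E. (f u)\<^sup>2) \<and>
      (\<Sum>(u, v)\<in>E. if f u = 0 then 0 else 1) \<le> 2 * real N * (real N + 1) ^ (m + 1)"
    proof (cases "m + 2 \<le> n")
      case True
      then show ?thesis using glue.IH corner_extremal by (meson atLeastAtMost_iff)
    next
      case False
      then have n: "n = Suc m" using m by simp
      have supp: "(\<Sum>(u, v)\<in>E. if f u = 0 then 0 else 1) \<le> 2 * real N * (real N + 1) ^ (m + 1)"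
        for f :: "nat list \<Rightarrow> real"
      proof -
        have "(\<Sum>(u, v)\<in>E. if f u = 0 then 0 else 1) \<le> (\<Sum>(u, v)\<in>E. 1 :: real)"
          by (rule sum_mono) auto
        then show ?thesis using viscek_card_edges[OF N_ge_2 glue.hyps(1)] n
          by (simp add: case_prod_unfold)
      qed
      show ?thesis
        using viscek_plateau[OF N_ge_2 glue.hyps(1), rule_format, OF n, of x] corner_extremal supp by auto
    qed
    then obtain f where f: "\<forall>v\<in>V. 0 \<le> f v" "\<forall>i\<in>{1..N}. f (x i) = 0"
      "edge_energy E f \<le> real N / 3 ^ m" "2 * real N * (real N + 1) ^ m \<le> (\<Sum>(u, v)\<in>E. (f u)\<^sup>2)"
      "(\<Sum>(u, v)\<in>E. if f u = 0 then 0 else 1) \<le> 2 * real N * (real N + 1) ^ (m + 1)" by blast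
    obtain g where g: "\<And>w. w \<in> V' \<Longrightarrow> 0 \<le> g w" "\<And>w. extremal V' E' w \<Longrightarrow> g w = 0"
      "edge_energy E' g = edge_energy E f"
      "\<And>h :: real \<Rightarrow> real. h 0 = 0 \<Longrightarrow> (\<Sum>(u, v)\<in>E'. h (g u)) = (\<Sum>(u, v)\<in>E. h (f u))"
      by (rule extend_by_zero[of f]) (use f glue.hyps(3) in auto)
    show "\<exists>f. (\<forall>v\<in>V'. 0 \<le> f v) \<and> (\<forall>v. extremal V' E' v \<longrightarrow> f v = 0) \<and>
      edge_energy E' f \<le> real N / 3 ^ m \<and> 2 * real N * (real N + 1) ^ m \<le> (\<Sum>(u, v)\<in>E'. (f u)\<^sup>2) \<and>
      (\<Sum>(u, v)\<in>E'. if f u = 0 then 0 else 1) \<le> 2 * real N * (real N + 1) ^ (m + 1)"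
      using g(1,2,3) f(3-5) g(4)[of "\<lambda>a. a\<^sup>2"] g(4)[of "\<lambda>a. if a = 0 then 0 else 1"]
      by (intro exI[of _ g]) auto
  qed
qed simp

text \<open>No constant \<open>k\<close> is close to both values, and each value is taken at least \<open>N div 2 \<ge> N / 3\<close>
  times.\<close>
lemma half_split_spread:
  fixes N :: nat and k M :: real
  assumes "N \<ge> 2" "M \<ge> 0"
  shows "real N * M / 6 \<le> (\<Sum>i=1..N. M * ((if i \<le> N div 2 then 0 else 1) - k)\<^sup>2)"
proof -
  let ?h = "N div 2"
  let ?g = "\<lambda>i. M * ((if i \<le> ?h then 0 else 1) - k)\<^sup>2"
  have split: "{1..N} = {1..?h} \<union> {?h + 1..N}" by auto
  have "sum ?g {1..N} = sum ?g {1..?h} + sum ?g {?h + 1..N}"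
    unfolding split by (rule sum.union_disjoint) auto
  also have "\<dots> = (\<Sum>i\<in>{1..?h}. M * k\<^sup>2) + (\<Sum>i\<in>{?h + 1..N}. M * (1 - k)\<^sup>2)"
    by (intro arg_cong2[where f = "(+)"] sum.cong) auto
  also have "\<dots> = real ?h * (M * k\<^sup>2) + real (N - ?h) * (M * (1 - k)\<^sup>2)" by simp
  also have "\<dots> \<ge> real ?h * (M * k\<^sup>2) + real ?h * (M * (1 - k)\<^sup>2)"
    using assms(2) by (intro add_left_mono mult_right_mono) auto
  finally have 1: "real ?h * M * (k\<^sup>2 + (1 - k)\<^sup>2) \<le> (\<Sum>i=1..N. M * ((if i \<le> ?h then 0 else 1) - k)\<^sup>2)"
    by (simp add: algebra_simps)
  have "k\<^sup>2 + (1 - k)\<^sup>2 \<ge> 1 / 2"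
    using zero_le_power2[of "2 * k - 1"] by (simp add: power2_eq_square algebra_simps)
  then have "real ?h * M * (1 / 2) \<le> real ?h * M * (k\<^sup>2 + (1 - k)\<^sup>2)"
    using assms(2) by (intro mult_left_mono) auto
  moreover have "N \<le> 3 * ?h" using assms(1) by presburger
  then have "real N \<le> 3 * real ?h" by linarith
  then have "real N * M \<le> 3 * real ?h * M" using assms(2) by (intro mult_right_mono) auto
  ultimately show ?thesis using 1 by simp
qed

text \<open>In the central copy the function has to be \<open>0\<close> at the first half of the corners and \<open>1\<close> at the
  others. Starting from the two-point functions \<open>s i j\<close>, the minimum over \<open>i\<close> of the maximum over
  \<open>j\<close> has these values; the maximum is written as a complement of a minimum of complements.\<close>
lemma viscek_split:
  assumes "N \<ge> 2" "viscek N n V E"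
  shows "\<exists>f. (\<forall>v\<in>V. 0 \<le> f v \<and> f v \<le> 1) \<and> edge_energy E f \<le> 3 * (real N)\<^sup>2 / 3 ^ n \<and>
    (\<forall>k. real (card E) / 12 \<le> (\<Sum>(u, v)\<in>E. (f u - k)\<^sup>2))"
  using assms
proof (induction rule: viscek_induct)
  case star
  define f where "f v = (if v = [0] then 1 / 2 else if hd v \<le> N div 2 then 0 else 1 :: real)" for v
  have "edge_energy (star_edges N) f = (\<Sum>i=1..N. 1 / 2)"
    unfolding edge_energy_def sum_star_edges
    by (rule sum.cong) (auto simp: f_def power2_eq_square)
  also have "\<dots> \<le> 3 * (real N)\<^sup>2"
    using mult_right_mono[of 1 "real N" "real N"] assms(1) by (simp add: power2_eq_square)
  finally have "edge_energy (star_edges N) f \<le> 3 * (real N)\<^sup>2 / 3 ^ 0" by simp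
  moreover have "real (card (star_edges N)) / 12 \<le> (\<Sum>(u, v)\<in>star_edges N. (f u - k)\<^sup>2)" for k
  proof -
    have "real (card (star_edges N)) / 12 = real N * 1 / 6"
      using viscek_card_edges[OF assms(1) viscek_0] by simp
    also have "\<dots> \<le> (\<Sum>i=1..N. 1 * ((if i \<le> N div 2 then 0 else 1) - k)\<^sup>2)"
      by (rule half_split_spread) (use assms(1) in auto)
    also have "\<dots> \<le> (\<Sum>i=1..N. (f [0] - k)\<^sup>2 + (f [i] - k)\<^sup>2)"
      by (rule sum_mono) (auto simp: f_def)
    also have "\<dots> = (\<Sum>(u, v)\<in>star_edges N. (f u - k)\<^sup>2)" by (simp add: sum_star_edges)
    finally show ?thesis .
  qed
  moreover have "\<forall>v\<in>star_verts N. 0 \<le> f v \<and> f v \<le> 1" by (simp add: f_def)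
  ultimately show ?case by blast
next
  case (glue n V E x)
  then interpret gluing V E N x by simp
  let ?h = "N div 2"
  let ?I = "{1..?h}" and ?J = "{?h + 1..N}"
  have ne: "?I \<noteq> {}" "?J \<noteq> {}" using N_ge_2 by auto
  have "\<forall>i\<in>?I. \<forall>j\<in>?J. \<exists>s. (\<forall>v\<in>V. 0 \<le> s v \<and> s v \<le> 1) \<and> s (x i) = 0 \<and> s (x j) = 1 \<and> edge_energy E s \<le> 1 / 3 ^ n"
    using corner_in corner_dist by (intro ballI viscek_two_point[OF N_ge_2 glue.hyps(1), rule_format]) auto
  then obtain s where s: "\<And>i j. i \<in> ?I \<Longrightarrow> j \<in> ?J \<Longrightarrow> (\<forall>v\<in>V. 0 \<le> s i j v \<and> s i j v \<le> 1) \<and>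
      s i j (x i) = 0 \<and> s i j (x j) = 1 \<and> edge_energy E (s i j) \<le> 1 / 3 ^ n"
    by metis
  define p where "p i v = (MIN j\<in>?J. 1 - s i j v)" for i v
  define f where "f v = (MIN i\<in>?I. 1 - p i v)" for v
  have p01: "0 \<le> p i v \<and> p i v \<le> 1" if "i \<in> ?I" "v \<in> V" for i v
  proof -
    have "p i v \<in> (\<lambda>j. 1 - s i j v) ` ?J" unfolding p_def using ne by (intro Min_in) auto
    then show ?thesis using s that by auto
  qed
  have f01: "0 \<le> f v \<and> f v \<le> 1" if "v \<in> V" for v
  proof -
    have "f v \<in> (\<lambda>i. 1 - p i v) ` ?I" unfolding f_def using ne by (intro Min_in) auto
    then show ?thesis using p01 that by auto
  qed
  have f0: "f (x i) = 0" if i: "i \<in> ?I" for i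
  proof -
    have "(\<lambda>j. 1 - s i j (x i)) ` ?J = {1}" using s[OF i] ne by auto
    then have "p i (x i) = 1" by (simp add: p_def)
    moreover have "f (x i) \<le> 1 - p i (x i)" unfolding f_def using i by (intro Min_le) auto
    moreover have "0 \<le> f (x i)" using f01 corner_in[of i] i by auto
    ultimately show ?thesis by simp
  qed
  have f1: "f (x j) = 1" if j: "j \<in> ?J" for j
  proof -
    have xj: "x j \<in> V" using corner_in[of j] j by auto
    have "p i (x j) = 0" if i: "i \<in> ?I" for i
    proof -
      have "p i (x j) \<le> 1 - s i j (x j)" unfolding p_def using j by (intro Min_le) auto
      then show ?thesis using p01[OF i xj] s[OF i j] by simp
    qed
    then have "(\<lambda>i. 1 - p i (x j)) ` ?I = {1}" using ne by auto
    then show ?thesis by (simp add: f_def)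
  qed
  define F where "F k = (if k = 0 then f else (\<lambda>_. if k \<le> ?h then 0 else 1))" for k :: nat
  have F: "glued F (c k w) = F k w" if "k \<le> N" for k w
    by (rule glued_copy) (use that f0[of k] f1[of k] in \<open>auto simp: F_def\<close>)
  have "edge_energy E' (glued F) = (\<Sum>k\<le>N. edge_energy E (F k))" by (simp add: energy_glue F)
  also have "\<dots> = (\<Sum>k\<in>{0}. edge_energy E (F k))"
    by (rule sum.mono_neutral_right) (auto simp: F_def energy_const)
  also have "\<dots> = edge_energy E f" by (simp add: F_def)
  also have "\<dots> \<le> (\<Sum>i\<in>?I. edge_energy E (\<lambda>v. 1 - p i v))"
    unfolding f_def by (rule energy_min_le) (use ne in auto)
  also have "\<dots> \<le> (\<Sum>i\<in>?I. \<Sum>j\<in>?J. edge_energy E (\<lambda>v. 1 - s i j v))"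
    unfolding energy_complement[of _ "p _"] unfolding p_def
    by (intro sum_mono energy_min_le) (use ne in auto)
  also have "\<dots> \<le> (\<Sum>i\<in>?I. \<Sum>j\<in>?J. 1 / 3 ^ n)"
    unfolding energy_complement using s by (intro sum_mono) auto
  also have "\<dots> = real (?h * (N - ?h)) / 3 ^ n" by simp
  also have "\<dots> \<le> real (N * N) / 3 ^ n"
    by (intro divide_right_mono of_nat_mono mult_le_mono) auto
  finally have "edge_energy E' (glued F) \<le> 3 * (real N)\<^sup>2 / 3 ^ Suc n" by (simp add: power2_eq_square)
  moreover have "\<forall>w\<in>V'. 0 \<le> glued F w \<and> glued F w \<le> 1"
    using f01 by (auto elim!: glue_verts_cases simp: F F_def)
  moreover have "real (card E') / 12 \<le> (\<Sum>(u, v)\<in>E'. (glued F u - k)\<^sup>2)" for k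
  proof -
    have "real (card E') / 12 = (real N + 1) * real (card E) / 12" by (simp add: card_glue_edges algebra_simps)
    also have "\<dots> \<le> real N * real (card E) / 6"
    proof -
      have "(real N + 1) * real (card E) \<le> 2 * real N * real (card E)"
        by (rule mult_right_mono) (use N_ge_2 in auto)
      then show ?thesis by linarith
    qed
    also have "\<dots> \<le> (\<Sum>i=1..N. real (card E) * ((if i \<le> ?h then 0 else 1) - k)\<^sup>2)"
      by (rule half_split_spread) (use N_ge_2 in auto)
    also have "\<dots> = (\<Sum>i=1..N. \<Sum>(u, v)\<in>E. (F i u - k)\<^sup>2)"
      by (rule sum.cong) (auto simp: F_def case_prod_unfold)
    also have "\<dots> \<le> (\<Sum>i\<le>N. \<Sum>(u, v)\<in>E. (F i u - k)\<^sup>2)"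
      by (rule sum_subset_le) (auto intro!: sum_nonneg)
    also have "\<dots> = (\<Sum>(u, v)\<in>E'. (glued F u - k)\<^sup>2)" by (simp add: sum_glue F)
    finally show ?thesis .
  qed
  ultimately show ?case by blast
qed

section \<open>Scaling\<close>

lemma power_level:
  fixes q \<rho> :: real
  assumes "q > 1" "\<rho> \<le> q ^ n"
  obtains l where "l \<le> n" "\<rho> \<le> q ^ l" "l = 0 \<or> q ^ (l - 1) < \<rho>"
proof -
  define l where "l = (LEAST l. \<rho> \<le> q ^ l)"
  have 1: "\<rho> \<le> q ^ l" unfolding l_def using assms(2) by (rule LeastI)
  have 2: "l \<le> n" unfolding l_def using assms(2) by (rule Least_le)
  have "l = 0 \<or> q ^ (l - 1) < \<rho>"
    using not_less_Least[of "l - 1" "\<lambda>l. \<rho> \<le> q ^ l"] by (cases l) (auto simp: l_def[symmetric])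
  then show thesis using that 1 2 by blast
qed

text \<open>With \<open>\<beta> = 1 + 1 / d\<close> the relation \<open>q powr (1 / d) = 3\<close> becomes \<open>q powr \<beta> = 3 q\<close>. In terms of \<open>\<rho> = r q\<^sup>n\<close>, which is the mass \<open>r\<close> measured in
  units of a star, both bounds say that the profile at \<open>r\<close> is comparable to \<open>\<rho> powr - \<beta>\<close>.\<close>
context
  fixes N n :: nat and V :: "nat list set" and E :: "(nat list \<times> nat list) set" and q \<beta> :: real
  assumes N: "N \<ge> 2" and V: "viscek N n V E" and q: "q = real N + 1"
    and \<beta>: "\<beta> > 0" "q powr \<beta> = 3 * q"
begin

interpretation finite_graph V E using viscek_graph[OF N V] by simp

lemma scale_powr: "(q ^ k) powr \<beta> = (3 * q) ^ k"
proof -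
  have "(q ^ k) powr \<beta> = (q powr \<beta>) ^ k"
    using q by (simp add: powr_realpow[symmetric] powr_powr powr_power mult.commute)
  then show ?thesis by (simp add: \<beta>)
qed

lemma card_E: "real (card E) = 2 * real N * q ^ n"
  using viscek_card_edges[OF N V] by (simp add: q)

text \<open>Let \<open>k\<close> be a level whose copies have more mass than \<open>r\<close>, or \<open>n\<close> if there is none; in the
  latter case the oscillation bound itself is a Poincare inequality. The loss in passing from
  \<open>q\<^sup>k\<close> to \<open>\<rho>\<close> is bounded since \<open>\<rho> \<ge> 1 / (2 N)\<close>, the mass of a single ordered edge.\<close>
lemma viscek_profile_lower:
  assumes r: "stat_min V E \<le> r" "r \<le> 1"
  shows "1 / (4 * real N * ((2 * real N * q\<^sup>2) powr \<beta> * (r * q ^ n) powr \<beta>)) \<le> spectral_profile V E r"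
proof -
  define \<rho> where "\<rho> = r * q ^ n"
  have q1: "q > 1" using N q by simp
  have "1 / real (card E) \<le> r" using stat_min_ge r by simp
  then have \<rho>_low: "1 \<le> 2 * real N * \<rho>"
    using N q1 by (simp add: card_E \<rho>_def field_simps)
  then have "0 < 2 * real N * \<rho>" by linarith
  then have \<rho>_pos: "\<rho> > 0" using N by (simp add: zero_less_mult_iff)
  have "\<rho> \<le> q ^ n" using r q1 by (simp add: \<rho>_def mult_left_le_one_le)
  with q1 obtain l where l: "l \<le> n" "\<rho> \<le> q ^ l" "l = 0 \<or> q ^ (l - 1) < \<rho>"
    by (rule power_level)
  \<comment> \<open>The Faber--Krahn inequality needs the strict bound \<open>\<rho> < q ^ k\<close>, hence the successor.\<close>
  define k where "k = (if l < n then Suc l else n)"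
  have k: "k \<le> n" "k = n \<or> \<rho> < q ^ k"
  proof -
    have "q ^ l < q ^ Suc l" using q1 by (intro power_strict_increasing) auto
    then show "k \<le> n" "k = n \<or> \<rho> < q ^ k" using l by (auto simp: k_def)
  qed
  have k_up: "q ^ k \<le> 2 * real N * q\<^sup>2 * \<rho>"
  proof -
    have "q ^ k \<le> q ^ Suc l" using l(1) q1 by (intro power_increasing) (auto simp: k_def)
    also have "\<dots> \<le> q\<^sup>2 * (2 * real N * \<rho>)"
      using l(3)
    proof
      assume "l = 0"
      then have "q ^ Suc l \<le> q\<^sup>2 * 1" using q1 by (simp add: power2_eq_square)
      also have "\<dots> \<le> q\<^sup>2 * (2 * real N * \<rho>)" using \<rho>_low by (intro mult_left_mono) auto
      finally show ?thesis .
    next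
      assume l': "q ^ (l - 1) < \<rho>"
            have "q ^ Suc l \<le> q ^ (2 + (l - 1))" using q1 by (intro power_increasing) auto
      also have "\<dots> = q\<^sup>2 * q ^ (l - 1)" by (rule power_add)
      also have "\<dots> \<le> q\<^sup>2 * (2 * real N * \<rho>)"
      proof (rule mult_left_mono)
        have "1 * \<rho> \<le> (2 * real N) * \<rho>" using N \<rho>_pos by (intro mult_right_mono) auto
        then show "q ^ (l - 1) \<le> 2 * real N * \<rho>" using l' by simp
      qed simp
      finally show ?thesis .
    qed
    finally show ?thesis by (simp add: algebra_simps)
  qed
  have "1 / (4 * real N * (3 * q) ^ k) \<le> spectral_profile V E r"
  proof (rule profile_lower[OF r(1)])
    fix f :: "nat list \<Rightarrow> real"
    assume mass: "(\<Sum>x | x \<in> V \<and> f x \<noteq> 0. stat V E x) \<le> r"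
    have E0: "dirichlet_form V E f f * (2 * real (card E)) = edge_energy E f"
      using edges_nonempty by (simp add: dirichlet_energy)
    have "stat_var V E f \<le> 4 * real N * (3 * q) ^ k * dirichlet_form V E f f"
    proof (cases "\<rho> < q ^ k")
      case True
      have "(\<Sum>(u, v)\<in>E. if f u = 0 then 0 else 1) \<le> r * real (card E)"
        using mass edges_nonempty unfolding support_mass by (simp add: field_simps)
      also have "\<dots> = 2 * real N * \<rho>" by (simp add: card_E \<rho>_def)
      also have "\<dots> < 2 * real N * q ^ k" using True N by simp
      finally have "(\<Sum>(u, v)\<in>E. (f u)\<^sup>2) \<le> 2 * real N * q ^ k * 3 ^ k * edge_energy E f"
        unfolding q by (intro viscek_faber_krahn[OF N V k(1)])
      then have "(\<Sum>(u, v)\<in>E. (f u)\<^sup>2) \<le> 4 * real N * (3 * q) ^ k * dirichlet_form V E f f * real (card E)"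
        unfolding E0[symmetric] by (simp add: power_mult_distrib algebra_simps)
      moreover have "stat_var V E f \<le> (\<Sum>(u, v)\<in>E. (f u)\<^sup>2) / real (card E)"
        using var_le_sum_sq[of f 0] by (simp add: sum_stat)
      ultimately show ?thesis using edges_nonempty
        by (meson order_trans divide_le_eq of_nat_0_less_iff)
    next
      case False
      then have k: "k = n" using k by simp
      obtain z where z: "z \<in> V" using verts_nonempty by auto
      have "stat_var V E f \<le> (\<Sum>x\<in>V. (f x - f z)\<^sup>2 * stat V E x)" by (rule var_le_sum_sq)
      also have "\<dots> \<le> (\<Sum>x\<in>V. 3 ^ n * edge_energy E f * stat V E x)"
        using viscek_oscillation[OF N V] z by (intro sum_mono mult_right_mono stat_nonneg) auto
      also have "\<dots> = 3 ^ n * edge_energy E f"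
        by (simp only: sum_distrib_left[symmetric] sum_stat_1 mult_1_right)
      also have "\<dots> = 4 * real N * (3 * q) ^ k * dirichlet_form V E f f"
        unfolding E0[symmetric] by (simp add: k card_E power_mult_distrib)
      finally show ?thesis .
    qed
    moreover have "4 * real N * (3 * q) ^ k > 0" using N q1 by simp
    ultimately show "1 / (4 * real N * (3 * q) ^ k) * stat_var V E f \<le> dirichlet_form V E f f"
      by (simp add: field_simps)
  qed
  moreover have "(3 * q) ^ k \<le> (2 * real N * q\<^sup>2) powr \<beta> * \<rho> powr \<beta>"
  proof -
    have "(3 * q) ^ k \<le> (2 * real N * q\<^sup>2 * \<rho>) powr \<beta>"
      unfolding scale_powr[symmetric] using k_up \<beta> q1 by (intro powr_mono2) auto
    then show ?thesis using q1 \<rho>_pos by (simp add: powr_mult)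
  qed
  then have "1 / (4 * real N * ((2 * real N * q\<^sup>2) powr \<beta> * \<rho> powr \<beta>)) \<le> 1 / (4 * real N * (3 * q) ^ k)"
    using N q1 \<rho>_pos by (intro divide_left_mono mult_left_mono) auto
  ultimately show ?thesis unfolding \<rho>_def by simp
qed

text \<open>If \<open>\<rho>\<close> exceeds \<open>q\<close>, the bump with \<open>q\<^sup>m\<^sup>+\<^sup>1 < \<rho> \<le> q\<^sup>m\<^sup>+\<^sup>2\<close> has a small enough support. Otherwise
  the claimed bound is at least \<open>4\<close>, and the indicator of a single vertex suffices.\<close>
lemma viscek_profile_upper:
  assumes r: "stat_min V E \<le> r" "r \<le> 1"
  shows "spectral_profile V E r \<le> 4 * (3 * q)\<^sup>2 / (r * q ^ n) powr \<beta>"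
proof -
  define \<rho> where "\<rho> = r * q ^ n"
  have q1: "q > 1" using N q by simp
  have "r > 0" using stat_min_ge r edges_nonempty
    by (meson less_le_trans of_nat_0_less_iff zero_less_divide_1_iff)
  then have \<rho>0: "\<rho> > 0" using q1 by (simp add: \<rho>_def)
  have \<rho>: "\<rho> \<le> q ^ n" using r q1 by (simp add: \<rho>_def mult_left_le_one_le)
  have "spectral_profile V E r \<le> 4 * (3 * q)\<^sup>2 / \<rho> powr \<beta>"
  proof (cases "\<rho> \<le> q")
    case True
    obtain x where x: "x \<in> V" "stat V E x = stat_min V E" using stat_min_attained by auto
    define f where "f y = (if y = x then 1 else 0 :: real)" for y
    have S: "{y. y \<in> V \<and> f y \<noteq> 0} = {x}" using x by (auto simp: f_def)
    have Q: "(\<Sum>(u, v)\<in>E. (f u)\<^sup>2) > 0"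
    proof -
      obtain y where y: "(x, y) \<in> E" using has_edge x by auto
      have "0 < (f x)\<^sup>2" by (simp add: f_def)
      also have "\<dots> \<le> (\<Sum>(u, v)\<in>E. (f u)\<^sup>2)"
        using member_le_sum[OF y, of "\<lambda>(u, v). (f u)\<^sup>2"] finite_edges by auto
      finally show ?thesis .
    qed
    have "spectral_profile V E r \<le> edge_energy E f / (\<Sum>(u, v)\<in>E. (f u)\<^sup>2)"
      by (rule profile_upper[of f x])
        (use x r singleton_mass_le_half[OF x(1)] in \<open>simp_all only: S\<close>, simp_all add: f_def)
    also have "\<dots> \<le> 4" using energy_le_4_sum_sq[of f] Q by (simp add: field_simps)
    also have "4 \<le> 4 * (3 * q)\<^sup>2 / \<rho> powr \<beta>"
    proof -
      have "\<rho> powr \<beta> \<le> q powr \<beta>" using True \<rho>0 \<beta> by (intro powr_mono2) auto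
      also have "\<dots> \<le> (3 * q)\<^sup>2" using q1 self_le_power[of "3 * q" 2] by (simp add: \<beta>)
      finally show ?thesis using \<rho>0 by (simp add: field_simps)
    qed
    finally show ?thesis .
  next
    case False
    obtain l where l: "l \<le> n" "\<rho> \<le> q ^ l" "l = 0 \<or> q ^ (l - 1) < \<rho>"
      using q1 \<rho> by (rule power_level)
    have "l \<noteq> 0" "l \<noteq> 1" using l(2) False q1 by (auto intro: Nat.gr0I)
    then have "\<exists>m. l = m + 2" by presburger
    then obtain m where m: "l = m + 2" by auto
    then have mn: "m + 2 \<le> n" and m1: "q ^ (m + 1) < \<rho>" using l by auto
    obtain f where f: "\<forall>v\<in>V. 0 \<le> f v" "edge_energy E f \<le> real N / 3 ^ m"
      "2 * real N * q ^ m \<le> (\<Sum>(u, v)\<in>E. (f u)\<^sup>2)"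
      "(\<Sum>(u, v)\<in>E. if f u = 0 then 0 else 1) \<le> 2 * real N * q ^ (m + 1)"
      using viscek_bump[OF N V, rule_format, OF mn] unfolding q by blast
    have Qpos: "2 * real N * q ^ m > 0" using N q1 by simp
    have mass: "(\<Sum>x | x \<in> V \<and> f x \<noteq> 0. stat V E x) \<le> q ^ (m + 1) / q ^ n"
    proof -
      have "(\<Sum>x | x \<in> V \<and> f x \<noteq> 0. stat V E x) \<le> 2 * real N * q ^ (m + 1) / real (card E)"
        unfolding support_mass using f(4) by (intro divide_right_mono) auto
      then show ?thesis using N by (simp add: card_E)
    qed
    have r': "q ^ (m + 1) / q ^ n \<le> r" using m1 q1 by (simp add: \<rho>_def field_simps)
    have half: "q ^ (m + 1) / q ^ n \<le> 1 / 2"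
    proof -
      have "2 * q ^ (m + 1) \<le> q * q ^ (m + 1)" using N q by (intro mult_right_mono) auto
      also have "\<dots> = q ^ (m + 2)" by simp
      also have "\<dots> \<le> q ^ n" using mn q1 by (intro power_increasing) auto
      finally show ?thesis using q1 by (simp add: field_simps)
    qed
    have "\<exists>v\<in>V. f v \<noteq> 0"
    proof (rule ccontr)
      assume "\<not> ?thesis"
      then have "(\<Sum>(u, v)\<in>E. (f u)\<^sup>2) = (\<Sum>(u, v)\<in>E. 0)" by (intro sum.cong) (auto dest: edge_verts)
      then show False using f(3) Qpos by (simp add: case_prod_unfold)
    qed
    then obtain v where v: "v \<in> V" "f v \<noteq> 0" by blast
    have "spectral_profile V E r \<le> edge_energy E f / (\<Sum>(u, v)\<in>E. (f u)\<^sup>2)"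
      by (rule profile_upper[of f v]) (use f(1) v order_trans[OF mass half] order_trans[OF mass r'] in auto)
    also have "\<dots> \<le> (real N / 3 ^ m) / (2 * real N * q ^ m)"
      using f(2,3) Qpos edge_energy_nonneg[of E f] by (intro frac_le) auto
    also have "\<dots> = 1 / (2 * (3 * q) ^ m)" using N by (simp add: power_mult_distrib)
    also have "\<dots> \<le> 4 * (3 * q)\<^sup>2 / (3 * q) ^ (m + 2)"
    proof -
      have *: "1 / (2 * y ^ m) \<le> 4 * y\<^sup>2 / y ^ (m + 2)" if "y > 0" for y :: real
        using that by (simp add: power2_eq_square field_simps)
      show ?thesis by (rule *) (use q1 in simp)
    qed
    also have "\<dots> \<le> 4 * (3 * q)\<^sup>2 / \<rho> powr \<beta>"
    proof (rule divide_left_mono)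
      show "\<rho> powr \<beta> \<le> (3 * q) ^ (m + 2)"
        unfolding scale_powr[symmetric] using l(2) m \<rho>0 \<beta> by (intro powr_mono2) auto
    qed (use q1 \<rho>0 in auto)
    finally show ?thesis .
  qed
  then show ?thesis by (simp add: \<rho>_def)
qed

lemma viscek_mixing:
  shows "ereal ((3 * q) ^ n / (72 * real N)) \<le> mixing_time V E 1 (1 / exp 1)"
    and "mixing_time V E 1 (1 / exp 1) \<le> mixing_time V E \<infinity> (1 / exp 1)"
    and "mixing_time V E \<infinity> (1 / exp 1) \<le> ereal (4 * exp 1 * real N * (3 * q) ^ n)"
proof -
  obtain f where f: "\<forall>v\<in>V. 0 \<le> f v \<and> f v \<le> 1" "edge_energy E f \<le> 3 * (real N)\<^sup>2 / 3 ^ n"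
    "\<forall>k. real (card E) / 12 \<le> (\<Sum>(u, v)\<in>E. (f u - k)\<^sup>2)"
    using viscek_split[OF N V] by blast
  have "ereal (real (card E) / (48 * (3 * (real N)\<^sup>2 / 3 ^ n))) \<le> mixing_time V E 1 (1 / exp 1)"
    by (rule mixing_time_1_ge[of f]) (use f N in auto)
  moreover have "real (card E) / (48 * (3 * (real N)\<^sup>2 / 3 ^ n)) = (3 * q) ^ n / (72 * real N)"
    using N by (simp add: card_E power_mult_distrib power2_eq_square field_simps)
  ultimately show "ereal ((3 * q) ^ n / (72 * real N)) \<le> mixing_time V E 1 (1 / exp 1)" by simp
  show "mixing_time V E 1 (1 / exp 1) \<le> mixing_time V E \<infinity> (1 / exp 1)"
    by (rule mixing_time_1_le_infinity)
  have "mixing_time V E \<infinity> (1 / exp 1) \<le> ereal (2 * exp 1 * 3 ^ n * real (card E))"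
    by (rule mixing_time_infinity_le) (use viscek_oscillation[OF N V] in auto)
  then show "mixing_time V E \<infinity> (1 / exp 1) \<le> ereal (4 * exp 1 * real N * (3 * q) ^ n)"
    by (simp add: card_E power_mult_distrib mult_ac)
qed

end

theorem lemma4p5:
  fixes N :: nat
  assumes "N \<ge> 2"
  shows "\<exists>a A b B :: real. a > 0 \<and> A > 0 \<and> b > 0 \<and> B > 0 \<and>
    (\<forall>n V E. viscek N n V E \<longrightarrow>
      (let d = log 3 (real N + 1); \<gamma> = real (graph_diam V E) in
        \<gamma> = 2 * 3 ^ n \<and>
        (\<forall>r. stat_min V E \<le> r \<and> r \<le> 1 \<longrightarrow>
          a / (\<gamma> powr (d + 1) * r powr (1 + 1 / d)) \<le> spectral_profile V E r \<and>
          spectral_profile V E r \<le> A / (\<gamma> powr (d + 1) * r powr (1 + 1 / d))) \<and>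
        ereal (b * \<gamma> powr (d + 1)) \<le> mixing_time V E 1 (1 / exp 1) \<and>
        mixing_time V E 1 (1 / exp 1) \<le> mixing_time V E \<infinity> (1 / exp 1) \<and>
        mixing_time V E \<infinity> (1 / exp 1) \<le> ereal (B * \<gamma> powr (d + 1))))"
proof -
  define q d \<beta> where "q = real N + 1" and "d = log 3 q" and "\<beta> = 1 + 1 / d"
  have q: "q > 1" "q \<ge> 3" using assms by (auto simp: q_def)
  have d: "d > 0" using q by (simp add: d_def)
  have powr_d: "3 powr d = q" using q by (simp add: d_def)
  have "q powr (1 / d) = 3"
    using d by (simp add: powr_d[symmetric] powr_powr)
  then have \<beta>: "\<beta> > 0" "q powr \<beta> = 3 * q"
    using d q by (auto simp: \<beta>_def powr_add add_pos_pos)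
  define C where "C = (2 * real N * q\<^sup>2) powr \<beta>"
  have C: "C > 0" using assms q by (simp add: C_def)
  define M where "M = (2::real) powr (d + 1)"
  have M: "M > 0" by (simp add: M_def)
  show ?thesis
  proof (intro exI conjI allI impI)
    show "M / (4 * real N * C) > 0" "M * (4 * (3 * q)\<^sup>2) > 0" "1 / (72 * real N * M) > 0" "4 * exp 1 * real N / M > 0"
      using C M assms q by auto
    fix n V E assume V: "viscek N n V E"
    interpret finite_graph V E using viscek_graph[OF assms V] by simp
    have \<gamma>: "real (graph_diam V E) = 2 * 3 ^ n" using viscek_graph[OF assms V] by simp
    have scale: "(2 * 3 ^ n) powr (d + 1) = M * (3 * q) ^ n"
    proof -
      have "(3 ^ n) powr (d + 1) = (3 powr (d + 1)) ^ n"
        by (simp add: powr_realpow[symmetric] powr_powr powr_power mult.commute)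
      also have "3 powr (d + 1) = 3 * q" by (simp add: powr_add powr_d)
      finally show ?thesis by (simp add: powr_mult M_def)
    qed
    have profile: "M / (4 * real N * C) / ((2 * 3 ^ n) powr (d + 1) * r powr \<beta>) \<le> spectral_profile V E r \<and>
        spectral_profile V E r \<le> M * (4 * (3 * q)\<^sup>2) / ((2 * 3 ^ n) powr (d + 1) * r powr \<beta>)"
      if r: "stat_min V E \<le> r" "r \<le> 1" for r
    proof -
      have "r > 0" using stat_min_ge r edges_nonempty
        by (meson less_le_trans of_nat_0_less_iff zero_less_divide_1_iff)
      then have "(r * q ^ n) powr \<beta> = (3 * q) ^ n * r powr \<beta>"
        using q scale_powr[OF assms V q_def \<beta>, of n] by (simp add: powr_mult)
      then have "(2 * 3 ^ n) powr (d + 1) * r powr \<beta> = M * (r * q ^ n) powr \<beta>"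
        by (simp add: scale)
      then show ?thesis
        using viscek_profile_lower[OF assms V q_def \<beta> r] viscek_profile_upper[OF assms V q_def \<beta> r] M
        by (simp add: C_def[symmetric])
    qed
    show "let d = log 3 (real N + 1); \<gamma> = real (graph_diam V E) in
        \<gamma> = 2 * 3 ^ n \<and>
        (\<forall>r. stat_min V E \<le> r \<and> r \<le> 1 \<longrightarrow>
          M / (4 * real N * C) / (\<gamma> powr (d + 1) * r powr (1 + 1 / d)) \<le> spectral_profile V E r \<and>
          spectral_profile V E r \<le> M * (4 * (3 * q)\<^sup>2) / (\<gamma> powr (d + 1) * r powr (1 + 1 / d))) \<and>
        ereal (1 / (72 * real N * M) * \<gamma> powr (d + 1)) \<le> mixing_time V E 1 (1 / exp 1) \<and>
        mixing_time V E 1 (1 / exp 1) \<le> mixing_time V E \<infinity> (1 / exp 1) \<and>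
        mixing_time V E \<infinity> (1 / exp 1) \<le> ereal (4 * exp 1 * real N / M * \<gamma> powr (d + 1))"
      unfolding Let_def \<gamma> q_def[symmetric] d_def[symmetric] \<beta>_def[symmetric]
      using profile viscek_mixing[OF assms V q_def \<beta>] M by (simp add: scale mult.assoc)
  qed
qed

end
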